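(* Suppose $f\in H^2$ and $f=\eta F$, where $\eta$ is inner and $F$ has no zeros in $\mathbb{D}$. Suppose \[ F^\alpha=c_1K_{w_1,\alpha}+c_2K_{w_2,\alpha} \] for some $\alpha>1$, some $(c_1,c_2)\in\mathbb{C}^2$ and some $(w_1,w_2)\in\mathbb{D}^2$. Then for any $1\le\beta\le\alpha$, we have \[ \|F\|_{A_\alpha^{2\alpha}}\le\|F\|_{A_\beta^{2\beta}}. \] Equality holds if and only if $F^\alpha=cK_{w,\alpha}$ for some $c\in\mathbb{C}$ and $w\in\mathbb{D}$. As a consequence, we have \[ \|f\|_{A_\alpha^{2\alpha}}\le\|f\|_{H^2}. \] Equality holds if and only if $f=cK_{w,1}$ for some $c\in\mathbb{C}$ and $w\in\mathbb{D}$.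
   Context: $\mathbb{D}$ is the open unit disc in $\mathbb{C}$. $H^2$ is the Hardy space of holomorphic functions $f$ on $\mathbb{D}$ with $\|f\|_{H^2}=\sup_{0<r<1}\big(\int_0^{2\pi}|f(re^{i\theta})|^2\frac{d\theta}{2\pi}\big)^{1/2}<\infty$. For $\alpha>1$, $0<p<\infty$ and $f$ holomorphic on $\mathbb{D}$, \[ \|f\|_{A_\alpha^p}=\Big(\int_{\mathbb{D}}|f(z)|^p(\alpha-1)(1-|z|^2)^{\alpha-2}\,\frac{dx\,dy}{\pi}\Big)^{1/p}. \] By convention $A_1^2=H^2$, with $\|f\|_{A_1^{2}}=\|f\|_{H^2}$. For $w\in\mathbb{D}$ and $\alpha>0$, $K_{w,\alpha}(z)=\frac{1}{(1-\overline{w}z)^\alpha}$ (principal branch). For a zero-free holomorphic $F$ on $\mathbb{D}$, $F^\alpha$ denotes $e^{\alpha h}$, where $h$ is a holomorphic function with $F=e^h$.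
   Formalization: The equality characterization for F is stated for 1 ≤ β < α only; at β = α both norms are the same number, so equality always holds and the literal "if and only if" fails for a genuine combination of two kernels. *)

theory Defs
  imports "HOL-Complex_Analysis.Complex_Analysis"
begin

abbreviation unit_disc :: "complex set" (\<open>\<bbbD>\<close>)
  where "\<bbbD> \<equiv> ball 0 1"

(* x^a for x in [0,\<infinity>], only ever used with a > 0; in particular \<infinity>^a = \<infinity>. *)
definition ennpow :: "ennreal \<Rightarrow> real \<Rightarrow> ennreal"
  where "ennpow x a = (if x = \<infinity> then \<infinity> else ennreal (enn2real x powr a))"

(* The norms take values in [0,\<infinity>], so that a function outside the space has norm \<infinity>. *)
definition hardy_norm :: "(complex \<Rightarrow> complex) \<Rightarrow> ennreal"
  where "hardy_norm f =
    (SUP r\<in>{0<..<1::real}.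
      ennpow (\<integral>\<^sup>+\<theta>\<in>{0..2*pi}. ennreal (norm (f (of_real r * cis \<theta>)) ^ 2 / (2 * pi)) \<partial>lborel) (1/2))"

definition hardy_space :: "(complex \<Rightarrow> complex) set"
  where "hardy_space = {f. f holomorphic_on \<bbbD> \<and> hardy_norm f < \<infinity>}"

(* The norm of A_\<alpha>^p, with the convention A_1^2 = H^2; meaningful for
   \<alpha> > 1, p > 0 and for \<alpha> = 1, p = 2. Area measure dx dy is lborel on complex. *)
definition bergman_norm :: "real \<Rightarrow> real \<Rightarrow> (complex \<Rightarrow> complex) \<Rightarrow> ennreal"
  where "bergman_norm \<alpha> p f =
    (if \<alpha> = 1 \<and> p = 2 then hardy_norm f
     else ennpow (\<integral>\<^sup>+z\<in>\<bbbD>. ennreal (norm (f z) powr p * (\<alpha> - 1) *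
                    (1 - (norm z)\<^sup>2) powr (\<alpha> - 2) / pi) \<partial>lborel) (1/p))"

(* For w, z in the disc, 1 - cnj w * z has positive real part, and the complex powr
   is the principal branch there. *)
definition disc_kernel :: "complex \<Rightarrow> real \<Rightarrow> complex \<Rightarrow> complex"
  where "disc_kernel w \<alpha> z = 1 / ((1 - cnj w * z) powr complex_of_real \<alpha>)"

(* Inner functions: holomorphic, bounded by 1, with radial limits of modulus 1
   at almost every boundary point. *)
definition inner_function :: "(complex \<Rightarrow> complex) \<Rightarrow> bool"
  where "inner_function \<eta> \<longleftrightarrow>
    \<eta> holomorphic_on \<bbbD> \<and> (\<forall>z\<in>\<bbbD>. norm (\<eta> z) \<le> 1) \<and>
    (AE \<theta> in lborel. \<theta> \<in> {0..2*pi} \<longrightarrow>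
       (\<exists>l. ((\<lambda>r. \<eta> (of_real r * cis \<theta>)) \<longlongrightarrow> l) (at_left (1::real)) \<and> norm l = 1))"

(* The power F^\<alpha> of a zero-free F = exp h on the disc. It depends on F and on the choice
   of the holomorphic logarithm h, which is unique up to a constant in 2 \<pi> i \<int>; another
   choice multiplies F^\<alpha> by a unimodular constant. *)
definition holomorphic_log_of :: "(complex \<Rightarrow> complex) \<Rightarrow> (complex \<Rightarrow> complex) \<Rightarrow> bool"
  where "holomorphic_log_of h F \<longleftrightarrow> h holomorphic_on \<bbbD> \<and> (\<forall>z\<in>\<bbbD>. F z = exp (h z))"

definition log_power :: "(complex \<Rightarrow> complex) \<Rightarrow> real \<Rightarrow> complex \<Rightarrow> complex"
  where "log_power h \<alpha> z = exp (of_real \<alpha> * h z)"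

end

theory Submission
  imports Defs
begin

text \<open>
  Why the theorem is true. Let \<open>w1\<close> and \<open>w2\<close> be distinct; otherwise \<open>F\<^sup>\<alpha>\<close> is a multiple of one kernel,
  and for such \<open>F\<close> all the norms coincide (\<open>bergman_norm_kernel\<close>). For every \<open>\<beta> \<ge> 1\<close> the quantity \<open>bergman_norm \<beta> (2 * \<beta>) F\<close>, raised to the
  power \<open>2 * \<beta>\<close>, is the squared norm of \<open>F\<^sup>\<beta> = log_power h \<beta>\<close> in a Hilbert space of functions on the disc
  with reproducing kernel \<open>disc_kernel w \<beta>\<close> (the Hardy space for \<open>\<beta> = 1\<close>). Such a norm is at least the norm
  of the combination of the kernels at \<open>w1\<close> and \<open>w2\<close> that takes the same values as \<open>F\<^sup>\<beta>\<close> at these two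
  points, and for \<open>\<beta> = \<alpha>\<close> there is equality, because \<open>F\<^sup>\<alpha>\<close> is itself such a combination. The norm of
  the interpolant has a closed form: it is \<open>exp (\<beta> * (p + q)) * N \<beta>\<close> with
  \<open>N \<beta> = (cosh (\<beta> * t) - exp (- (\<beta> * s)) * cos (\<beta> * \<psi>)) / (exp (- (\<beta> * s)) * sinh (\<beta> * s))\<close>, where \<open>s > 0\<close>
  depends on the hyperbolic distance of \<open>w1\<close> and \<open>w2\<close>, \<open>t = p - q\<close> compares the normalized sizes of
  \<open>F w1\<close> and \<open>F w2\<close>, and \<open>\<psi>\<close> is the normalized difference of their phases
  (\<open>two_kernel_interpolation\<close>). So the inequality for \<open>F\<close> reduces to the fact that
  \<open>ln (N \<beta>) / \<beta>\<close> decreases in \<open>\<beta>\<close> (\<open>ln_two_point_norm_decreasing\<close>). It does so strictly, unless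
  \<open>\<psi> = 0\<close> and \<open>\<bar>t\<bar> = s\<close>, and in that case one of the two coefficients vanishes.

  The monotonicity needs \<open>\<alpha> * \<bar>\<psi>\<bar> \<le> pi\<close>, and this is where the absence of zeros enters
  (\<open>phase_bound\<close>): along the hyperbolic geodesic from \<open>w1\<close> to \<open>w2\<close> the quotient of \<open>F\<^sup>\<alpha>\<close> by
  \<open>disc_kernel w1 \<alpha>\<close> is an affine function of a real parameter, so it runs through a line segment,
  and along a segment that misses the origin the argument changes by less than \<open>pi\<close>.

  For \<open>f = \<eta> * F\<close>, the representation of \<open>F\<^sup>\<alpha>\<close> by two kernels shows that \<open>F\<close> is bounded. Since the radial limits
  of \<open>\<eta>\<close> have modulus one, dominated convergence gives \<open>hardy_norm F \<le> hardy_norm f\<close>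
  (\<open>hardy_norm_inner_multiple\<close>), while \<open>\<bar>f\<bar> \<le> \<bar>F\<bar>\<close> makes the Bergman norm of \<open>f\<close> at most that of \<open>F\<close>.
  Equality forces \<open>F\<^sup>\<alpha>\<close> to be a multiple of one kernel and \<open>\<bar>\<eta>\<bar>\<close> to be \<open>1\<close> somewhere in the disc, and the
  maximum principle finishes the proof.
\<close>

section \<open>Monotonicity of the two-point norm\<close>

lemma cosh_minus_pos:
  fixes s t p :: real
  assumes "s > 0"
  shows "cosh t - exp (-s) * cos p > 0"
proof -
  have "exp (-s) * cos p \<le> exp (-s)" by simp
  also have "\<dots> < 1" using assms by simp
  also have "1 \<le> cosh t" by (rule cosh_real_ge_1)
  finally show ?thesis by simp
qed

text \<open>
  Minus the derivative at \<open>1\<close> of \<open>l \<mapsto> ln (N l) / l\<close>, where \<open>N l\<close> is the two-point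
  norm with parameters \<open>s\<close>, \<open>t\<close> and phase \<open>p\<close>. Rescaling the parameters moves any other point
  to \<open>1\<close>, so the monotonicity amounts to the positivity of this function.
\<close>

definition monotonicity_gap :: "real \<Rightarrow> real \<Rightarrow> real \<Rightarrow> real"
  where "monotonicity_gap s t p = ln ((cosh t - exp (-s) * cos p) / sinh s) + s * cosh s / sinh s
     - (t * sinh t + exp (-s) * (s * cos p + p * sin p)) / (cosh t - exp (-s) * cos p)"

lemma has_derivative_gap_phase:
  assumes s: "s > 0"
  shows "((\<lambda>p. monotonicity_gap s t p) has_real_derivative
     exp (-s) * (cosh t * (s * sin p - p * cos p) + t * sinh t * sin p + exp (-s) * p)
       / (cosh t - exp (-s) * cos p)\<^sup>2) (at p)"
proof -
  define A where "A = cosh t - exp (-s) * cos p"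
  have A: "A > 0" unfolding A_def by (rule cosh_minus_pos[OF s])
  have S: "sinh s > 0" using s by simp
  have "((\<lambda>p. monotonicity_gap s t p) has_real_derivative
     exp (-s) * sin p / A 
     - ((exp (-s) * (p * cos p + sin p - s * sin p)) * A 
        - (t * sinh t + exp (-s) * (s * cos p + p * sin p)) * (exp (-s) * sin p)) / A^2) (at p)"
    unfolding monotonicity_gap_def A_def using A S unfolding A_def
    by (auto intro!: derivative_eq_intros) (simp_all add: power2_eq_square divide_simps)
  also have "exp (-s) * sin p / A 
     - ((exp (-s) * (p * cos p + sin p - s * sin p)) * A 
        - (t * sinh t + exp (-s) * (s * cos p + p * sin p)) * (exp (-s) * sin p)) / A^2
    = (exp (-s) * (A * (s * sin p - p * cos p) 
         + (t * sinh t + exp (-s) * (s * cos p + p * sin p)) * sin p)) / A^2"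
    using A by (simp add: divide_simps power2_eq_square) (simp add: algebra_simps)
  also have "A * (s * sin p - p * cos p) 
         + (t * sinh t + exp (-s) * (s * cos p + p * sin p)) * sin p
     = cosh t * (s * sin p - p * cos p) + t * sinh t * sin p + exp (-s) * p * ((sin p)\<^sup>2 + (cos p)\<^sup>2)"
    unfolding A_def by (simp add: algebra_simps power2_eq_square del: sin_cos_squared_add sin_cos_squared_add2 sin_cos_squared_add3)
  finally show ?thesis by (simp add: A_def)
qed

lemma has_derivative_gap_ratio:
  assumes s: "s > 0"
  shows "((\<lambda>t. monotonicity_gap s t 0) has_real_derivative
     exp (-s) * (s * sinh t + t * cosh t - t * exp s) / (cosh t - exp (-s))\<^sup>2) (at t)"
proof -
  define A where "A = cosh t - exp (-s)"
  have A: "A > 0" unfolding A_def using cosh_minus_pos[OF s, of t 0] by simp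
  have S: "sinh s > 0" using s by simp
  have "((\<lambda>t. monotonicity_gap s t 0) has_real_derivative
     sinh t / A - ((sinh t + t * cosh t) * A - (t * sinh t + exp (-s) * s) * sinh t) / A^2) (at t)"
    unfolding monotonicity_gap_def A_def using A S unfolding A_def
    by (auto intro!: derivative_eq_intros) (simp_all add: power2_eq_square divide_simps)
  also have "sinh t / A - ((sinh t + t * cosh t) * A - (t * sinh t + exp (-s) * s) * sinh t) / A^2
    = ((t * sinh t + exp (-s) * s) * sinh t - t * cosh t * A) / A^2"
    using A by (simp add: divide_simps power2_eq_square) (simp add: algebra_simps)
  also have "(t * sinh t + exp (-s) * s) * sinh t - t * cosh t * A
     = exp (-s) * (s * sinh t + t * cosh t) - t * ((cosh t)\<^sup>2 - (sinh t)\<^sup>2)"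
    unfolding A_def by (simp add: algebra_simps power2_eq_square)
  also have "(cosh t)\<^sup>2 - (sinh t)\<^sup>2 = exp (-s) * exp s"
    by (simp add: hyperbolic_pythagoras flip: exp_add)
  also have "exp (- s) * (s * sinh t + t * cosh t) - t * (exp (- s) * exp s)
     = exp (- s) * (s * sinh t + t * cosh t - t * exp s)" by (simp add: algebra_simps)
  finally show ?thesis by (simp add: A_def)
qed

text \<open>
  The term with \<open>p * cos p\<close> is the only one that can be negative. It is controlled by
  \<open>p * cos p \<le> sin p\<close> and \<open>cosh t - 1 \<le> t * sinh t\<close>, after which \<open>1 - s < exp (-s)\<close> suffices. Hence the gap
  increases with the phase, and only the phase \<open>0\<close> has to be examined.
\<close>

lemma gap_phase_derivative_pos:
  fixes s t p :: real
  assumes s: "s > 0" and p: "0 < p" "p < pi"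
  shows "cosh t * (s * sin p - p * cos p) + t * sinh t * sin p + exp (-s) * p > 0"
proof -
  have sin: "0 < sin p" "sin p \<le> p" using p sin_gt_zero[of p] sin_x_le_x[of p] by auto
  have 1: "p * cos p \<le> sin p"
  proof -
    have "sin 0 - 0 * cos 0 \<le> sin p - p * cos p"
    proof (rule DERIV_nonneg_imp_nondecreasing[of 0 p "\<lambda>x. sin x - x * cos x"])
      fix x assume x: "0 \<le> x" "x \<le> p"
      have "((\<lambda>x. sin x - x * cos x) has_real_derivative x * sin x) (at x)"
        by (auto intro!: derivative_eq_intros)
      moreover have "x * sin x \<ge> 0" using x p by (intro mult_nonneg_nonneg sin_ge_zero) auto
      ultimately show "\<exists>y. ((\<lambda>x. sin x - x * cos x) has_real_derivative y) (at x) \<and> 0 \<le> y" by blast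
    qed (use p in auto)
    thus ?thesis by simp
  qed
  have 2: "cosh t - 1 \<le> t * sinh t"
  proof -
    have *: "cosh u - 1 \<le> u * sinh u" if "u \<ge> 0" for u :: real
    proof -
      have "0 * sinh 0 - cosh 0 \<le> u * sinh u - cosh u"
      proof (rule DERIV_nonneg_imp_nondecreasing[of 0 u "\<lambda>x. x * sinh x - cosh x"])
        fix x assume x: "0 \<le> x" "x \<le> u"
        have "((\<lambda>x. x * sinh x - cosh x) has_real_derivative x * cosh x) (at x)"
          by (auto intro!: derivative_eq_intros)
        moreover have "x * cosh x \<ge> 0" using x by simp
        ultimately show "\<exists>y. ((\<lambda>x. x * sinh x - cosh x) has_real_derivative y) (at x) \<and> 0 \<le> y" by blast
      qed (use that in auto)
      thus ?thesis by simp
    qed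
    show ?thesis using *[of t] *[of "-t"] by (cases "t \<ge> 0") auto
  qed
  have 3: "exp (-s) * p > (1 - s) * sin p"
  proof (cases "s < 1")
    case True
    have "1 - s < exp (-s)" using s exp_minus_greater[of s] by simp
    hence "(1-s) * sin p < exp (-s) * sin p" using sin by simp
    also have "\<dots> \<le> exp (-s) * p" using sin by simp
    finally show ?thesis .
  next
    case False
    hence "(1 - s) * sin p \<le> 0" using sin by (simp add: mult_nonpos_nonneg)
    also have "0 < exp (-s) * p" using p by simp
    finally show ?thesis .
  qed
  have "cosh t * (s * sin p - p * cos p) + t * sinh t * sin p 
      \<ge> cosh t * (s * sin p - sin p) + (cosh t - 1) * sin p"
    using 1 2 sin by (intro add_mono mult_left_mono mult_right_mono) auto
  also have "cosh t * (s * sin p - sin p) + (cosh t - 1) * sin p = (s * cosh t - 1) * sin p"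
    by (simp add: algebra_simps)
  finally have "cosh t * (s * sin p - p * cos p) + t * sinh t * sin p \<ge> (s * cosh t - 1) * sin p" .
  moreover have "(s * cosh t - 1) * sin p \<ge> (s - 1) * sin p"
    using s sin cosh_real_ge_1[of t] by (intro mult_right_mono) auto
  ultimately show ?thesis using 3 by (simp add: algebra_simps)
qed

lemma sinh_less_times_cosh:
  fixes t :: real
  assumes "0 < t"
  shows "sinh t < t * cosh t"
proof -
  have "0 * cosh 0 - sinh 0 < t * cosh t - sinh t"
  proof (rule DERIV_pos_imp_increasing_open[of 0 t "\<lambda>x. x * cosh x - sinh x"])
    fix x assume x: "0 < x" "x < t"
    have "((\<lambda>x. x * cosh x - sinh x) has_real_derivative x * sinh x) (at x)"
      by (auto intro!: derivative_eq_intros)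
    moreover have "x * sinh x > 0" using x by simp
    ultimately show "\<exists>y. ((\<lambda>x. x * cosh x - sinh x) has_real_derivative y) (at x) \<and> 0 < y" by blast
  qed (use assms in \<open>auto intro!: continuous_intros\<close>)
  thus ?thesis by simp
qed

text \<open>
  Divided by \<open>t\<close>, the expression is \<open>H t - H s\<close> for an increasing function \<open>H\<close>. So for phase \<open>0\<close>
  the gap decreases up to \<open>t = s\<close> and increases afterwards, and its minimum is the value \<open>0\<close> at \<open>t = s\<close>.
\<close>

lemma gap_ratio_derivative_sign:
  fixes s t :: real
  assumes s: "s > 0" and t: "0 < t"
  shows "t < s \<Longrightarrow> s * sinh t + t * cosh t - t * exp s < 0"
    and "t > s \<Longrightarrow> s * sinh t + t * cosh t - t * exp s > 0"
proof -
  define H where "H = (\<lambda>u. s * (sinh u / u) + cosh u)"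
  have H: "H u < H v" if "0 < u" "u < v" for u v
  proof (rule DERIV_pos_imp_increasing[OF \<open>u < v\<close>])
    fix x assume x: "u \<le> x" "x \<le> v"
    have "(H has_real_derivative s * (x * cosh x - sinh x) / x^2 + sinh x) (at x)"
      unfolding H_def using x that
      by (auto intro!: derivative_eq_intros) (simp add: divide_simps power2_eq_square algebra_simps)
    moreover have "s * (x * cosh x - sinh x) / x^2 + sinh x > 0"
      using sinh_less_times_cosh[of x] x that s by (intro add_pos_pos divide_pos_pos mult_pos_pos) auto
    ultimately show "\<exists>y. (H has_real_derivative y) (at x) \<and> 0 < y" by blast
  qed
  have Hs: "H s = exp s" using s by (simp add: H_def sinh_plus_cosh)
  have eq: "s * sinh t + t * cosh t - t * exp s = t * (H t - H s)"
    using t unfolding Hs by (simp add: H_def algebra_simps)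
  show "t < s \<Longrightarrow> s * sinh t + t * cosh t - t * exp s < 0"
    unfolding eq using H[of t s] t by (simp add: mult_pos_neg)
  show "t > s \<Longrightarrow> s * sinh t + t * cosh t - t * exp s > 0"
    unfolding eq using H[of s t] s t by simp
qed

lemma gap_even [simp]: "monotonicity_gap s (-t) p = monotonicity_gap s t p" "monotonicity_gap s t (-p) = monotonicity_gap s t p"
  by (simp_all add: monotonicity_gap_def)

lemma gap_diagonal:
  assumes "s > 0"
  shows "monotonicity_gap s s 0 = 0"
proof -
  have S: "sinh s > 0" using assms by simp
  have A: "cosh s - exp (-s) = sinh s" by (metis add_diff_cancel_left' cosh_minus_sinh diff_diff_eq2 diff_add_cancel)
  have B: "s * sinh s + exp (-s) * s = s * cosh s" using A by (simp add: algebra_simps)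
  show ?thesis unfolding monotonicity_gap_def using S A B by simp
qed

lemma gap_real_pos:
  assumes s: "s > 0" and t: "t \<ge> 0" "t \<noteq> s"
  shows "monotonicity_gap s t 0 > 0"
proof (cases "t < s")
  case True
  have "monotonicity_gap s s 0 < monotonicity_gap s t 0"
  proof (rule DERIV_neg_imp_decreasing_open[OF True])
    fix x assume x: "t < x" "x < s"
    have "exp (-s) * (s * sinh x + x * cosh x - x * exp s) / (cosh x - exp (-s))\<^sup>2 < 0"
      using gap_ratio_derivative_sign(1)[OF s, of x] x t cosh_minus_pos[OF s, of x 0]
      by (intro divide_neg_pos mult_pos_neg) auto
    thus "\<exists>y. ((\<lambda>t. monotonicity_gap s t 0) has_real_derivative y) (at x) \<and> y < 0"
      using has_derivative_gap_ratio[OF s, of x] by blast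
  next
    show "continuous_on {t..s} (\<lambda>t. monotonicity_gap s t 0)"
      by (intro DERIV_atLeastAtMost_imp_continuous_on) (use has_derivative_gap_ratio[OF s] in blast)
  qed
  thus ?thesis by (simp add: gap_diagonal[OF s])
next
  case False
  hence st: "s < t" using t by simp
  have "monotonicity_gap s s 0 < monotonicity_gap s t 0"
  proof (rule DERIV_pos_imp_increasing_open[OF st])
    fix x assume x: "s < x" "x < t"
    have "exp (-s) * (s * sinh x + x * cosh x - x * exp s) / (cosh x - exp (-s))\<^sup>2 > 0"
      using gap_ratio_derivative_sign(2)[OF s, of x] x s cosh_minus_pos[OF s, of x 0]
      by (intro divide_pos_pos mult_pos_pos) auto
    thus "\<exists>y. ((\<lambda>t. monotonicity_gap s t 0) has_real_derivative y) (at x) \<and> y > 0"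
      using has_derivative_gap_ratio[OF s, of x] by blast
  next
    show "continuous_on {s..t} (\<lambda>t. monotonicity_gap s t 0)"
      by (intro DERIV_atLeastAtMost_imp_continuous_on) (use has_derivative_gap_ratio[OF s] in blast)
  qed
  thus ?thesis by (simp add: gap_diagonal[OF s])
qed

lemma gap_pos:
  assumes s: "s > 0" and p: "\<bar>p\<bar> \<le> pi" and ne: "p \<noteq> 0 \<or> \<bar>t\<bar> \<noteq> s"
  shows "monotonicity_gap s t p > 0"
proof -
  have ev: "monotonicity_gap s t p = monotonicity_gap s \<bar>t\<bar> \<bar>p\<bar>" by (simp add: abs_if)
  have nn: "monotonicity_gap s \<bar>t\<bar> 0 \<ge> 0"
    using gap_real_pos[OF s, of "\<bar>t\<bar>"] gap_diagonal[OF s] by (cases "\<bar>t\<bar> = s") auto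
  show ?thesis
  proof (cases "p = 0")
    case True
    with ne gap_real_pos[OF s, of "\<bar>t\<bar>"] ev show ?thesis by simp
  next
    case False
    have "monotonicity_gap s \<bar>t\<bar> 0 < monotonicity_gap s \<bar>t\<bar> \<bar>p\<bar>"
    proof (rule DERIV_pos_imp_increasing_open[where f = "monotonicity_gap s \<bar>t\<bar>"])
      fix x assume x: "0 < x" "x < \<bar>p\<bar>"
      have "exp (-s) * (cosh \<bar>t\<bar> * (s * sin x - x * cos x) + \<bar>t\<bar> * sinh \<bar>t\<bar> * sin x + exp (-s) * x)
          / (cosh \<bar>t\<bar> - exp (-s) * cos x)\<^sup>2 > 0"
        using gap_phase_derivative_pos[OF s, of x "\<bar>t\<bar>"] x p cosh_minus_pos[OF s, of "\<bar>t\<bar>" x]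
        by (intro divide_pos_pos mult_pos_pos) auto
      thus "\<exists>y. (monotonicity_gap s \<bar>t\<bar> has_real_derivative y) (at x) \<and> y > 0"
        using has_derivative_gap_phase[OF s, of "\<bar>t\<bar>" x] by blast
    next
      show "continuous_on {0..\<bar>p\<bar>} (monotonicity_gap s \<bar>t\<bar>)"
        by (intro DERIV_atLeastAtMost_imp_continuous_on) (use has_derivative_gap_phase[OF s] in blast)
    qed (use False in auto)
    with nn ev show ?thesis by simp
  qed
qed

text \<open>
  The squared norm of the smallest function with prescribed values at two points, for the kernel of
  exponent \<open>l\<close> and after normalization of the values: the two kernel vectors are unit vectors with
  inner product of modulus \<open>exp (- (l * s))\<close>, and the values have moduli \<open>exp (l * t / 2)\<close> and
  \<open>exp (- (l * t / 2))\<close> and relative phase \<open>l * \<psi>\<close>.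
\<close>

definition two_point_norm :: "real \<Rightarrow> real \<Rightarrow> real \<Rightarrow> real \<Rightarrow> real"
  where "two_point_norm s t \<psi> l = (cosh (l * t) - exp (- (l * s)) * cos (l * \<psi>)) / (exp (- (l * s)) * sinh (l * s))"

lemma two_point_norm_pos:
  assumes "s > 0" "l > 0"
  shows "two_point_norm s t \<psi> l > 0"
  unfolding two_point_norm_def using assms cosh_minus_pos[of "l * s" "l * t" "l * \<psi>"] by simp

text \<open>
  The derivative at \<open>l\<close> is minus the gap with parameters \<open>l * s\<close>, \<open>l * t\<close>, \<open>l * \<psi>\<close>, divided by \<open>l\<^sup>2\<close>. The
  bound on the phase at the larger exponent gives the bound at every \<open>l\<close> in between.
\<close>

lemma ln_two_point_norm_decreasing:
  assumes s: "s > 0" and ab: "0 < \<beta>" "\<beta> < \<alpha>" and psi: "\<alpha> * \<bar>\<psi>\<bar> \<le> pi" and ne: "\<psi> \<noteq> 0 \<or> \<bar>t\<bar> \<noteq> s"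
  shows "ln (two_point_norm s t \<psi> \<alpha>) / \<alpha> < ln (two_point_norm s t \<psi> \<beta>) / \<beta>"
proof (rule DERIV_neg_imp_decreasing[OF ab(2)])
  fix l assume l: "\<beta> \<le> l" "l \<le> \<alpha>"
  define A where "A = cosh (l*t) - exp (- (l * s)) * cos (l*\<psi>)"
  have A: "A > 0" unfolding A_def using cosh_minus_pos[of "l * s"] l s ab by simp
  have S: "sinh (l * s) > 0" using l s ab by simp
  have *: "two_point_norm s t \<psi> x = (cosh (x * t) - exp (- (x * s)) * cos (x * \<psi>)) * exp (x * s) / sinh (x * s)" for x
    by (simp add: two_point_norm_def exp_minus field_simps)
  have N: "two_point_norm s t \<psi> l = A * exp (l * s) / sinh (l * s)" unfolding * A_def ..
  have lnN: "ln (two_point_norm s t \<psi> l) = ln (A / sinh (l * s)) + l * s"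
    unfolding N using A S by (simp add: ln_mult ln_div)
  have 1: "(two_point_norm s t \<psi> has_real_derivative 
     ((t * sinh (l*t) + exp (- (l * s)) * (s * cos (l*\<psi>) + \<psi> * sin (l * \<psi>))) * exp (l * s) / sinh (l * s)
       + A * s * exp (l * s) / sinh (l * s) - A * exp (l * s) * s * cosh (l * s) / (sinh (l * s))^2)) (at l)"
    unfolding * A_def using S
    by (auto intro!: derivative_eq_intros) (simp add: divide_simps power2_eq_square, simp add: algebra_simps)
  define N' where "N' = ((t * sinh (l*t) + exp (- (l * s)) * (s * cos (l*\<psi>) + \<psi> * sin (l * \<psi>))) * exp (l * s) / sinh (l * s)
       + A * s * exp (l * s) / sinh (l * s) - A * exp (l * s) * s * cosh (l * s) / (sinh (l * s))^2)"
  have 2: "((\<lambda>x. ln (two_point_norm s t \<psi> x) / x) has_real_derivative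
     (N' / two_point_norm s t \<psi> l * l - ln (two_point_norm s t \<psi> l)) / l^2) (at l)"
    using l ab two_point_norm_pos[OF s, of l t \<psi>] 1 unfolding N'_def[symmetric]
    by (auto intro!: derivative_eq_intros) (simp add: divide_simps power2_eq_square)
  have 3: "N' / two_point_norm s t \<psi> l = (t * sinh (l*t) + exp (- (l * s)) * (s * cos (l*\<psi>) + \<psi> * sin (l * \<psi>))) / A
       + s - s * cosh (l * s) / sinh (l * s)"
    unfolding N N'_def using A S s l ab by (simp add: divide_simps power2_eq_square) (simp add: algebra_simps)
  have 4: "N' / two_point_norm s t \<psi> l * l - ln (two_point_norm s t \<psi> l) = - monotonicity_gap (l * s) (l*t) (l*\<psi>)"
    unfolding 3 lnN unfolding monotonicity_gap_def A_def[symmetric] by (simp add: add_divide_distrib algebra_simps)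
  have "monotonicity_gap (l * s) (l*t) (l*\<psi>) > 0"
  proof (rule gap_pos)
    have "l * \<bar>\<psi>\<bar> \<le> \<alpha> * \<bar>\<psi>\<bar>" using l by (intro mult_right_mono) auto
    thus "\<bar>l * \<psi>\<bar> \<le> pi" using psi l ab by (simp add: abs_mult)
  qed (use l s ab ne in \<open>auto simp: abs_mult\<close>)
  hence "(N' / two_point_norm s t \<psi> l * l - ln (two_point_norm s t \<psi> l)) / l^2 < 0"
    unfolding 4 using l ab by (simp add: divide_neg_pos)
  with 2 show "\<exists>y. ((\<lambda>x. ln (two_point_norm s t \<psi> x) / x) has_real_derivative y) (at l) \<and> y < 0" by blast
qed

section \<open>Rotation-invariant integration in the plane\<close>

lemma measurable_Complex [measurable]:
  assumes [measurable]: "f \<in> borel_measurable M" "g \<in> borel_measurable M"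
  shows "(\<lambda>x. Complex (f x) (g x)) \<in> borel_measurable M"
  unfolding Complex_eq by measurable

lemma lborel_complex: "(lborel :: complex measure) = distr (lborel \<Otimes>\<^sub>M lborel) borel (\<lambda>(x, y). Complex x y)"
proof (rule lborel_eqI)
  fix l u :: complex
  assume le: "\<And>b. b \<in> Basis \<Longrightarrow> l \<bullet> b \<le> u \<bullet> b"
  have le': "Re l \<le> Re u" "Im l \<le> Im u"
    using le[of 1] le[of \<i>] by (auto simp: Basis_complex_def inner_complex_def)
  have vim: "(\<lambda>(x, y). Complex x y) -` box l u \<inter> space (lborel \<Otimes>\<^sub>M lborel) = {Re l<..<Re u} \<times> {Im l<..<Im u}"
    by (auto simp: box_def Basis_complex_def inner_complex_def space_pair_measure)
  have "emeasure (distr (lborel \<Otimes>\<^sub>M lborel) borel (\<lambda>(x, y). Complex x y)) (box l u) =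
      emeasure (lborel \<Otimes>\<^sub>M lborel) ({Re l<..<Re u} \<times> {Im l<..<Im u})"
    by (subst emeasure_distr) (auto simp only: vim split: prod.split intro!: measurable_Complex, measurable)
  also have "\<dots> = emeasure lborel {Re l<..<Re u} * emeasure lborel {Im l<..<Im u}"
    by (rule lborel.emeasure_pair_measure_Times) auto
  also have "\<dots> = ennreal (\<Prod>b\<in>Basis. (u - l) \<bullet> b)"
    using le' by (simp add: Basis_complex_def inner_complex_def ennreal_mult)
  finally show "emeasure (distr (lborel \<Otimes>\<^sub>M lborel) borel (\<lambda>(x, y). Complex x y)) (box l u) = \<dots>" .
qed simp

lemma nn_integral_complex:
  assumes [measurable]: "q \<in> borel_measurable borel"
  shows "(\<integral>\<^sup>+z. q z \<partial>lborel) = (\<integral>\<^sup>+y. \<integral>\<^sup>+x. q (Complex x y) \<partial>lborel \<partial>lborel)"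
    and "(\<integral>\<^sup>+z. q z \<partial>lborel) = (\<integral>\<^sup>+x. \<integral>\<^sup>+y. q (Complex x y) \<partial>lborel \<partial>lborel)"
proof -
  have "(\<integral>\<^sup>+z. q z \<partial>lborel) = (\<integral>\<^sup>+z. q (case z of (x, y) \<Rightarrow> Complex x y) \<partial>(lborel \<Otimes>\<^sub>M lborel))"
    by (subst lborel_complex, subst nn_integral_distr) auto
  also have "\<dots> = (\<integral>\<^sup>+y. \<integral>\<^sup>+x. q (Complex x y) \<partial>lborel \<partial>lborel)"
    by (subst lborel_pair.nn_integral_snd[symmetric]) auto
  finally show "(\<integral>\<^sup>+z. q z \<partial>lborel) = (\<integral>\<^sup>+y. \<integral>\<^sup>+x. q (Complex x y) \<partial>lborel \<partial>lborel)" .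
  also have "\<dots> = (\<integral>\<^sup>+x. \<integral>\<^sup>+y. q (Complex x y) \<partial>lborel \<partial>lborel)"
    by (subst lborel_pair.Fubini'[where f = "\<lambda>x y. q (Complex x y)"]) auto
  finally show "(\<integral>\<^sup>+z. q z \<partial>lborel) = (\<integral>\<^sup>+x. \<integral>\<^sup>+y. q (Complex x y) \<partial>lborel \<partial>lborel)" .
qed

text \<open>
  Shears preserve area by Fubini and translation invariance on lines. They are the building blocks
  of rotations.
\<close>

lemma nn_integral_shear_Re:
  assumes [measurable]: "q \<in> borel_measurable borel"
  shows "(\<integral>\<^sup>+z. q (Complex (Re z + a * Im z) (Im z)) \<partial>lborel) = (\<integral>\<^sup>+z. q z \<partial>lborel)"
proof -
  have "(\<integral>\<^sup>+x. q (Complex x y) \<partial>lborel) = (\<integral>\<^sup>+x. q (Complex (x + a * y) y) \<partial>lborel)" for y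
    using nn_integral_real_affine[of "\<lambda>x. q (Complex x y)" 1 "a * y"] by (simp add: add.commute)
  thus ?thesis by (subst (1 2) nn_integral_complex(1)) simp_all
qed

lemma nn_integral_shear_Im:
  assumes [measurable]: "q \<in> borel_measurable borel"
  shows "(\<integral>\<^sup>+z. q (Complex (Re z) (Im z + a * Re z)) \<partial>lborel) = (\<integral>\<^sup>+z. q z \<partial>lborel)"
proof -
  have "(\<integral>\<^sup>+y. q (Complex x y) \<partial>lborel) = (\<integral>\<^sup>+y. q (Complex x (y + a * x)) \<partial>lborel)" for x
    using nn_integral_real_affine[of "\<lambda>y. q (Complex x y)" 1 "a * x"] by (simp add: add.commute)
  thus ?thesis by (subst (1 2) nn_integral_complex(2)) simp_all
qed

text \<open>
  A rotation by an angle whose sine does not vanish is a product of three shears.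
\<close>

lemma nn_integral_rotation_aux:
  assumes [measurable]: "q \<in> borel_measurable borel" and t: "sin t \<noteq> 0"
  shows "(\<integral>\<^sup>+z. q (z * cis t) \<partial>lborel) = (\<integral>\<^sup>+z. q z \<partial>lborel)"
proof -
  (* The diagonal entries of the product force 1 + a * sin t = cos t. *)
  define a where "a = (cos t - 1) / sin t"
  define S1 where "S1 = (\<lambda>z. Complex (Re z + a * Im z) (Im z))"
  define S2 where "S2 = (\<lambda>z. Complex (Re z) (Im z + sin t * Re z))"
  have [measurable]: "S1 \<in> borel_measurable borel" "S2 \<in> borel_measurable borel"
    unfolding S1_def S2_def by measurable
  have e1: "1 + a * sin t = cos t" using t by (simp add: a_def)
  have e2: "a * (1 + cos t) = - sin t"
  proof -
    have "(cos t - 1) * (1 + cos t) = - ((sin t)\<^sup>2)"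
      by (simp add: sin_squared_eq algebra_simps power2_eq_square)
    thus ?thesis using t by (simp add: a_def divide_simps power2_eq_square)
  qed
  have rot: "z * cis t = S1 (S2 (S1 z))" for z
  proof (rule complex_eqI)
    have "Re (S1 (S2 (S1 z))) = Re z * (1 + a * sin t) + Im z * (a * (1 + (1 + a * sin t)))"
      by (simp add: S1_def S2_def algebra_simps)
    also have "\<dots> = Re (z * cis t)" unfolding e1 e2 by simp
    finally show "Re (z * cis t) = Re (S1 (S2 (S1 z)))" ..
    have "Im (S1 (S2 (S1 z))) = Im z * (1 + a * sin t) + sin t * Re z"
      by (simp add: S1_def S2_def algebra_simps)
    also have "\<dots> = Im (z * cis t)" unfolding e1 by simp
    finally show "Im (z * cis t) = Im (S1 (S2 (S1 z)))" ..
  qed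
  have "(\<integral>\<^sup>+z. q (z * cis t) \<partial>lborel) = (\<integral>\<^sup>+z. q (S1 (S2 (S1 z))) \<partial>lborel)"
    by (simp add: rot)
  also have "\<dots> = (\<integral>\<^sup>+z. q (S1 (S2 z)) \<partial>lborel)"
    using nn_integral_shear_Re[of "\<lambda>z. q (S1 (S2 z))" a] by (simp add: S1_def)
  also have "\<dots> = (\<integral>\<^sup>+z. q (S1 z) \<partial>lborel)"
    using nn_integral_shear_Im[of "\<lambda>z. q (S1 z)" "sin t"] by (simp add: S2_def)
  also have "\<dots> = (\<integral>\<^sup>+z. q z \<partial>lborel)"
    using nn_integral_shear_Re[of "\<lambda>z. q z" a] by (simp add: S1_def)
  finally show ?thesis .
qed

lemma nn_integral_rotation:
  assumes [measurable]: "q \<in> borel_measurable borel"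
  shows "(\<integral>\<^sup>+z. q (z * cis t) \<partial>lborel) = (\<integral>\<^sup>+z. q z \<partial>lborel)"
proof (cases "sin t = 0")
  case False
  thus ?thesis by (simp add: nn_integral_rotation_aux)
next
  case True
  have "sin (t - pi/2) \<noteq> 0" using True sin_cos_squared_add[of t] by (auto simp: sin_diff)
  moreover have eq: "cis t = cis (t - pi/2) * cis (pi/2)"
    by (simp add: cis_mult del: cis_pi_half)
  ultimately show ?thesis
    using nn_integral_rotation_aux[of "\<lambda>z. q (z * cis (pi/2))" "t - pi/2"]
      nn_integral_rotation_aux[of q "pi/2"] by (simp only: eq) (simp add: mult.assoc)
qed

lemma measurable_cis [measurable]: "cis \<in> borel_measurable borel"
  by (intro borel_measurable_continuous_onI continuous_intros)

text \<open>
  Averaging the rotation invariance over all angles: this replaces polar coordinates, and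
  it leaves an integrand that depends on the radius only.
\<close>

lemma nn_integral_circle_average:
  assumes [measurable]: "q \<in> borel_measurable borel"
  shows "(\<integral>\<^sup>+z. q z \<partial>lborel) = (\<integral>\<^sup>+z. (\<integral>\<^sup>+\<theta>\<in>{0..2*pi}. q (z * cis \<theta>) * ennreal (1 / (2 * pi)) \<partial>lborel) \<partial>lborel)"
proof -
  have [measurable]: "(\<lambda>p. q (snd p * cis (fst p))) \<in> borel_measurable (lborel \<Otimes>\<^sub>M lborel)"
    by (rule measurable_compose[OF _ assms]) measurable
  have "(\<integral>\<^sup>+z. (\<integral>\<^sup>+\<theta>\<in>{0..2*pi}. q (z * cis \<theta>) * ennreal (1 / (2 * pi)) \<partial>lborel) \<partial>lborel)
     = (\<integral>\<^sup>+\<theta>. (\<integral>\<^sup>+z. q (z * cis \<theta>) * ennreal (1 / (2 * pi)) * indicator {0..2*pi} \<theta> \<partial>lborel) \<partial>lborel)"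
  proof (rule lborel_pair.Fubini')
    have "(\<lambda>p. q (snd p * cis (fst p)) * ennreal (1 / (2 * pi)) * indicator {0..2*pi} (fst p)) \<in> borel_measurable (lborel \<Otimes>\<^sub>M lborel)"
      by measurable
    thus "(\<lambda>(\<theta>, z). q (z * cis \<theta>) * ennreal (1 / (2 * pi)) * indicator {0..2*pi} \<theta>) \<in> borel_measurable (lborel \<Otimes>\<^sub>M lborel)"
      by (simp add: case_prod_unfold)
  qed
  also have "\<dots> = (\<integral>\<^sup>+\<theta>. (\<integral>\<^sup>+z. q z \<partial>lborel) * ennreal (1 / (2 * pi)) * indicator {0..2*pi} \<theta> \<partial>lborel)"
    by (intro nn_integral_cong) (simp add: nn_integral_multc nn_integral_rotation)
  also have "\<dots> = (\<integral>\<^sup>+z. q z \<partial>lborel) * (ennreal (1 / (2 * pi)) * ennreal (2 * pi))"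
    by (subst nn_integral_cmult) (auto simp: mult.assoc)
  also have "\<dots> = (\<integral>\<^sup>+z. q z \<partial>lborel)"
    by (subst ennreal_mult[symmetric]) auto
  finally show ?thesis ..
qed

text \<open>
  The area of a disc of radius \<open>sqrt a\<close> is \<open>pi * a\<close>, so under area measure the squared modulus
  is uniformly distributed with density \<open>pi\<close>.
\<close>

lemma emeasure_distr_norm_square:
  "emeasure (distr lborel borel (\<lambda>z::complex. (norm z)\<^sup>2)) {..<a} = ennreal pi * ennreal a"
proof (cases "a > 0")
  case True
  have "(\<lambda>z::complex. (norm z)\<^sup>2) -` {..<a} = ball 0 (sqrt a)"
  proof -
    have "(norm z)\<^sup>2 < a \<longleftrightarrow> norm z < sqrt a" for z :: complex
      by (metis abs_norm_cancel real_sqrt_abs real_sqrt_less_iff)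
    thus ?thesis by auto
  qed
  hence "emeasure (distr lborel borel (\<lambda>z::complex. (norm z)\<^sup>2)) {..<a} = emeasure lborel (ball (0::complex) (sqrt a))"
    by (subst emeasure_distr) auto
  also have "\<dots> = ennreal pi * ennreal a"
    using True by (subst emeasure_ball) (auto simp: unit_ball_vol_2 ennreal_mult)
  finally show ?thesis .
next
  case False
  have "\<not> (norm z)\<^sup>2 < a" for z :: complex
    using False zero_le_power2[of "norm z"] by linarith
  hence "(\<lambda>z::complex. (norm z)\<^sup>2) -` {..<a} = {}" by auto
  hence "emeasure (distr lborel borel (\<lambda>z::complex. (norm z)\<^sup>2)) {..<a} = emeasure lborel ({}::complex set)"
    by (subst emeasure_distr) auto
  thus ?thesis using False by (simp add: ennreal_neg)
qed

lemma distr_norm_square: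
  "distr lborel borel (\<lambda>z::complex. (norm z)\<^sup>2) = density lborel (\<lambda>t. ennreal pi * indicator {0..} t)"
proof (rule measure_eqI_generator_eq[where E = "range lessThan" and \<Omega> = UNIV and A = "\<lambda>n. {..<real n}"])
  have "{..<a} \<inter> {..<b} = {..<min a b}" for a b :: real by auto
  thus "Int_stable (range (lessThan :: real \<Rightarrow> real set))"
    by (auto simp: Int_stable_def)
next
  fix X :: "real set" assume "X \<in> range lessThan"
  then obtain a where X: "X = {..<a}" by auto
  have "emeasure (density lborel (\<lambda>t. ennreal pi * indicator {0..} t)) {..<a} = ennreal pi * emeasure lborel ({0..} \<inter> {..<a})"
    by (subst emeasure_density) (auto simp: mult.assoc nn_integral_cmult simp flip: indicator_inter_arith)
  also have "{0..} \<inter> {..<a} = {0..<a}" by auto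
  also have "emeasure lborel {0..<a} = ennreal a" by (cases "0 \<le> a") (auto simp: ennreal_neg)
  finally show "emeasure (distr lborel borel (\<lambda>z::complex. (norm z)\<^sup>2)) X = emeasure (density lborel (\<lambda>t. ennreal pi * indicator {0..} t)) X"
    unfolding X emeasure_distr_norm_square ..
next
  show "emeasure (distr lborel borel (\<lambda>z::complex. (norm z)\<^sup>2)) {..<real n} \<noteq> \<infinity>" for n
    unfolding emeasure_distr_norm_square by (simp add: ennreal_mult_eq_top_iff)
next
  show "(\<Union>n. {..<real n}) = UNIV" by (auto intro: reals_Archimedean2)
qed (auto simp: borel_Iio)

lemma nn_integral_disc_radial:
  fixes v :: "real \<Rightarrow> ennreal"
  assumes [measurable]: "v \<in> borel_measurable borel"
  shows "(\<integral>\<^sup>+z\<in>\<bbbD>. v ((norm z)\<^sup>2) \<partial>lborel) = ennreal pi * (\<integral>\<^sup>+t\<in>{0..<1}. v t \<partial>lborel)"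
proof -
  have "(\<integral>\<^sup>+z\<in>\<bbbD>. v ((norm z)\<^sup>2) \<partial>lborel) = (\<integral>\<^sup>+z. v ((norm z)\<^sup>2) * indicator {..<1} ((norm z)\<^sup>2) \<partial>(lborel :: complex measure))"
    by (intro nn_integral_cong) (auto simp: indicator_def abs_square_less_1)
  also have "\<dots> = (\<integral>\<^sup>+t. v t * indicator {..<1} t \<partial>distr lborel borel (\<lambda>z::complex. (norm z)\<^sup>2))"
    by (subst nn_integral_distr) auto
  also have "\<dots> = (\<integral>\<^sup>+t. ennreal pi * indicator {0..} t * (v t * indicator {..<1} t) \<partial>lborel)"
    unfolding distr_norm_square by (subst nn_integral_density) auto
  also have "\<dots> = (\<integral>\<^sup>+t. ennreal pi * (v t * indicator {0..<1} t) \<partial>lborel)"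
    by (intro nn_integral_cong) (auto simp: indicator_def)
  also have "\<dots> = ennreal pi * (\<integral>\<^sup>+t\<in>{0..<1}. v t \<partial>lborel)"
    by (rule nn_integral_cmult) auto
  finally show ?thesis .
qed

lemma pochhammer_Beta:
  fixes b :: real assumes "b > 1"
  shows "(b - 1) * Beta (real n + 1) (b - 1) = fact n / pochhammer b n"
proof -
  have nb: "b - 1 \<notin> \<int>\<^sub>\<le>\<^sub>0" using assms by (auto elim!: nonpos_Ints_cases)
  have "pochhammer b n = Gamma (b + real n) / Gamma b"
    using assms by (intro pochhammer_Gamma) (auto elim!: nonpos_Ints_cases)
  moreover have "Gamma b = (b - 1) * Gamma (b - 1)"
    using Gamma_plus1[OF nb] by simp
  moreover have "Gamma (real n + 1) = fact n"
    using Gamma_fact[of n, where 'a = real] by (simp add: add.commute)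
  moreover have "Beta (real n + 1) (b - 1) = Gamma (real n + 1) * Gamma (b - 1) / Gamma (b + real n)"
    by (simp add: Beta_def add.commute)
  ultimately show ?thesis by simp
qed

text \<open>
  The Beta integral: these are the squared norms of the monomials, and their inverses are the Taylor
  coefficients of the reproducing kernel.
\<close>

lemma nn_integral_monomial_weight:
  fixes b :: real assumes b: "b > 1"
  shows "(\<integral>\<^sup>+t\<in>{0..<1}. ennreal (t ^ n * ((b - 1) * (1 - t) powr (b - 2))) \<partial>lborel) = ennreal (fact n / pochhammer b n)"
proof -
  have "((\<lambda>t. t powr (real n + 1 - 1) * (1 - t) powr (b - 1 - 1)) has_integral Beta (real n + 1) (b - 1)) {0..1}"
    using b by (intro has_integral_Beta_real) auto
  hence "((\<lambda>t. t powr (real n + 1 - 1) * (1 - t) powr (b - 1 - 1)) has_integral Beta (real n + 1) (b - 1)) {0<..<1}"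
    by (simp add: has_integral_Icc_iff_Ioo)
  hence "((\<lambda>t. (b - 1) * (t powr (real n + 1 - 1) * (1 - t) powr (b - 1 - 1))) has_integral ((b - 1) * Beta (real n + 1) (b - 1))) {0<..<1}"
    by (rule has_integral_mult_right)
  moreover have "(b - 1) * (t powr (real n + 1 - 1) * (1 - t) powr (b - 1 - 1)) = t ^ n * ((b - 1) * (1 - t) powr (b - 2))"
    if "t \<in> {0<..<1}" for t :: real
  proof -
    have "t powr (real n + 1 - 1) = t ^ n" using that by (simp add: powr_realpow)
    moreover have "b - 1 - 1 = b - 2" by simp
    ultimately show ?thesis by (simp only: mult_ac)
  qed
  ultimately have "((\<lambda>t. t ^ n * ((b - 1) * (1 - t) powr (b - 2))) has_integral ((b - 1) * Beta (real n + 1) (b - 1))) {0<..<1}"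
    by (rule has_integral_eq[rotated])
  from nn_integral_has_integral_lebesgue[OF _ this] b
  have "(\<integral>\<^sup>+t. ennreal (indicator {0<..<1} t * (t ^ n * ((b - 1) * (1 - t) powr (b - 2)))) \<partial>lborel) = ennreal ((b - 1) * Beta (real n + 1) (b - 1))"
    by simp
  also have "(\<integral>\<^sup>+t. ennreal (indicator {0<..<1} t * (t ^ n * ((b - 1) * (1 - t) powr (b - 2)))) \<partial>lborel)
    = (\<integral>\<^sup>+t. ennreal (t ^ n * ((b - 1) * (1 - t) powr (b - 2))) * indicator {0<..<1} t \<partial>lborel)"
    by (intro nn_integral_cong) (simp add: indicator_def)
  also have "(\<integral>\<^sup>+t. ennreal (t ^ n * ((b - 1) * (1 - t) powr (b - 2))) * indicator {0<..<1} t \<partial>lborel)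
      = (\<integral>\<^sup>+t\<in>{0..<1}. ennreal (t ^ n * ((b - 1) * (1 - t) powr (b - 2))) \<partial>lborel)"
    by (rule nn_integral_cong_AE, rule AE_mp[OF AE_lborel_singleton[of 0]]) (auto simp: indicator_def)
  finally show ?thesis using pochhammer_Beta[OF b] by simp
qed

section \<open>Parseval's identity on the circle\<close>

lemma cis_has_integral_0:
  fixes m n :: nat
  assumes "m \<noteq> n"
  shows "((\<lambda>\<theta>. cis \<theta> ^ m * cnj (cis \<theta> ^ n)) has_integral 0) {0..2*pi}"
proof -
  define c where "c = \<i> * (of_nat m - of_nat n :: complex)"
  have c: "c \<noteq> 0" using assms by (simp add: c_def)
  have eq: "cis \<theta> ^ m * cnj (cis \<theta> ^ n) = exp (c * of_real \<theta>)" for \<theta>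
  proof -
    have "cis \<theta> ^ m * cnj (cis \<theta> ^ n) = cis (real m * \<theta> - real n * \<theta>)"
      unfolding Complex.DeMoivre cis_cnj cis_mult by simp
    also have "\<dots> = exp (c * of_real \<theta>)"
      unfolding cis_conv_exp c_def by (simp add: algebra_simps)
    finally show ?thesis .
  qed
  have "((\<lambda>\<theta>. exp (c * of_real \<theta>)) has_integral (exp (c * of_real (2*pi)) / c - exp (c * of_real 0) / c)) {0..2*pi}"
  proof (rule fundamental_theorem_of_calculus)
    fix x :: real
    have "((\<lambda>z. exp (c * z) / c) has_field_derivative exp (c * of_real x)) (at (of_real x))"
      using c by (auto intro!: derivative_eq_intros)
    thus "((\<lambda>x. exp (c * of_real x) / c) has_vector_derivative exp (c * of_real x)) (at x within {0..2*pi})"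
      by (rule has_vector_derivative_at_within[OF has_vector_derivative_real_field])
  qed simp
  also have "exp (c * of_real (2*pi)) = 1"
  proof -
    have "c * of_real (2*pi) = of_real (2 * of_int (int m - int n) * pi) * \<i>"
      by (simp add: c_def algebra_simps)
    thus ?thesis using exp_integer_2pi[OF Ints_of_int, of "int m - int n"] by (simp only:)
  qed
  finally show ?thesis unfolding eq by simp
qed

lemma norm_add_square_complex:
  fixes x y :: complex
  shows "(norm (x + y))\<^sup>2 = (norm x)\<^sup>2 + (norm y)\<^sup>2 + 2 * Re (x * cnj y)"
  unfolding cmod_power2 by (simp add: power2_eq_square algebra_simps)

text \<open>
  Each new term is orthogonal to the previous ones.
\<close>

lemma trig_polynomial_parseval:
  fixes u :: "nat \<Rightarrow> complex"
  shows "((\<lambda>\<theta>. (norm (\<Sum>n<N. u n * cis \<theta> ^ n))\<^sup>2) has_integral 2 * pi * (\<Sum>n<N. (norm (u n))\<^sup>2)) {0..2*pi}"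
proof (induction N)
  case (Suc N)
  have "((\<lambda>\<theta>. (\<Sum>n<N. u n * cnj (u N) * (cis \<theta> ^ n * cnj (cis \<theta> ^ N)))) has_integral (\<Sum>n<N. u n * cnj (u N) * 0)) {0..2*pi}"
    by (intro has_integral_sum has_integral_mult_right cis_has_integral_0) auto
  hence "((\<lambda>\<theta>. Re (\<Sum>n<N. u n * cnj (u N) * (cis \<theta> ^ n * cnj (cis \<theta> ^ N)))) has_integral Re 0) {0..2*pi}"
    by (intro has_integral_Re) simp
  hence cross: "((\<lambda>\<theta>. 2 * Re (\<Sum>n<N. u n * cnj (u N) * (cis \<theta> ^ n * cnj (cis \<theta> ^ N)))) has_integral 2 * Re 0) {0..2*pi}"
    by (rule has_integral_mult_right)
  have const: "((\<lambda>\<theta>. (norm (u N))\<^sup>2) has_integral (2 * pi - 0) *\<^sub>R (norm (u N))\<^sup>2) {0..2*pi}"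
    using has_integral_const_real[of "(norm (u N))\<^sup>2" 0 "2*pi"] by simp
  have eq: "(norm (\<Sum>n<Suc N. u n * cis \<theta> ^ n))\<^sup>2 = (norm (\<Sum>n<N. u n * cis \<theta> ^ n))\<^sup>2 + (norm (u N))\<^sup>2
      + 2 * Re (\<Sum>n<N. u n * cnj (u N) * (cis \<theta> ^ n * cnj (cis \<theta> ^ N)))" for \<theta>
  proof -
    have "(\<Sum>n<N. u n * cis \<theta> ^ n) * cnj (u N * cis \<theta> ^ N) = (\<Sum>n<N. u n * cnj (u N) * (cis \<theta> ^ n * cnj (cis \<theta> ^ N)))"
      unfolding sum_distrib_right by (intro sum.cong refl) (simp add: mult_ac)
    thus ?thesis
      unfolding sum.lessThan_Suc norm_add_square_complex by (simp only:) (simp add: norm_mult norm_power)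
  qed
  show ?case
    unfolding eq using has_integral_add[OF has_integral_add[OF Suc.IH const] cross]
    by (simp add: algebra_simps)
qed simp

text \<open>
  Absolute summability makes the partial sums uniformly bounded, so dominated convergence
  carries the finite identity over to the series.
\<close>

lemma parseval_circle:
  fixes u :: "nat \<Rightarrow> complex"
  assumes sm: "summable (\<lambda>n. norm (u n))"
  shows "(\<integral>\<^sup>+\<theta>\<in>{0..2*pi}. ennreal ((norm (\<Sum>n. u n * cis \<theta> ^ n))\<^sup>2 / (2 * pi)) \<partial>lborel) = (\<Sum>n. ennreal ((norm (u n))\<^sup>2))"
proof -
  define P where "P = (\<lambda>N \<theta>. (norm (\<Sum>n<N. u n * cis \<theta> ^ n))\<^sup>2 / (2 * pi))"
  have cP: "continuous_on UNIV (P N)" for N unfolding P_def by (intro continuous_intros) auto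
  have [measurable]: "P N \<in> borel_measurable borel" for N
    by (intro borel_measurable_continuous_onI cP)
  have sm': "summable (\<lambda>n. u n * cis \<theta> ^ n)" for \<theta>
    by (rule summable_norm_cancel) (simp add: norm_mult norm_power sm)
  have fin: "(\<integral>\<^sup>+\<theta>\<in>{0..2*pi}. ennreal (P N \<theta>) \<partial>lborel) = (\<Sum>n<N. ennreal ((norm (u n))\<^sup>2))" for N
  proof -
    have "((\<lambda>\<theta>. P N \<theta>) has_integral (2 * pi * (\<Sum>n<N. (norm (u n))\<^sup>2)) / (2 * pi)) {0..2*pi}"
      unfolding P_def by (intro has_integral_divide trig_polynomial_parseval)
    from nn_integral_has_integral_lebesgue[OF _ this]
    have "(\<integral>\<^sup>+\<theta>. ennreal (indicator {0..2*pi} \<theta> * P N \<theta>) \<partial>lborel) = ennreal (\<Sum>n<N. (norm (u n))\<^sup>2)"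
      by (simp add: P_def)
    also have "(\<integral>\<^sup>+\<theta>. ennreal (indicator {0..2*pi} \<theta> * P N \<theta>) \<partial>lborel) = (\<integral>\<^sup>+\<theta>\<in>{0..2*pi}. ennreal (P N \<theta>) \<partial>lborel)"
      by (intro nn_integral_cong) (simp add: indicator_def)
    finally show ?thesis by (simp add: sum_ennreal)
  qed
  define S where "S = (\<Sum>n. norm (u n))"
  have bd: "P N \<theta> \<le> S\<^sup>2 / (2 * pi)" for N \<theta>
  proof -
    have "norm (\<Sum>n<N. u n * cis \<theta> ^ n) \<le> (\<Sum>n<N. norm (u n * cis \<theta> ^ n))" by (rule norm_sum)
    also have "\<dots> = (\<Sum>n<N. norm (u n))" by (simp add: norm_mult norm_power)
    also have "\<dots> \<le> S" unfolding S_def by (rule sum_le_suminf[OF sm]) auto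
    finally show ?thesis unfolding P_def by (intro divide_right_mono power_mono) auto
  qed
  have lim: "(\<lambda>N. P N \<theta>) \<longlonglongrightarrow> (norm (\<Sum>n. u n * cis \<theta> ^ n))\<^sup>2 / (2 * pi)" for \<theta>
    unfolding P_def by (intro tendsto_intros summable_LIMSEQ sm') auto
  have [measurable]: "(\<lambda>\<theta>. (norm (\<Sum>n. u n * cis \<theta> ^ n))\<^sup>2 / (2 * pi)) \<in> borel_measurable borel"
    by (rule borel_measurable_LIMSEQ_real[OF lim]) auto
  have "(\<lambda>N. \<integral>\<^sup>+\<theta>\<in>{0..2*pi}. ennreal (P N \<theta>) \<partial>lborel) \<longlonglongrightarrow>
      (\<integral>\<^sup>+\<theta>\<in>{0..2*pi}. ennreal ((norm (\<Sum>n. u n * cis \<theta> ^ n))\<^sup>2 / (2 * pi)) \<partial>lborel)"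
  proof (rule nn_integral_dominated_convergence[where w = "\<lambda>\<theta>. ennreal (S\<^sup>2 / (2 * pi)) * indicator {0..2*pi} \<theta>"])
    show "AE \<theta> in lborel. ennreal (P N \<theta>) * indicator {0..2*pi} \<theta> \<le> ennreal (S\<^sup>2 / (2 * pi)) * indicator {0..2*pi} \<theta>" for N
      by (intro AE_I2 mult_right_mono ennreal_leI bd) auto
    show "(\<integral>\<^sup>+\<theta>. ennreal (S\<^sup>2 / (2 * pi)) * indicator {0..2*pi} \<theta> \<partial>lborel) < \<infinity>"
      by (subst nn_integral_cmult) (auto simp: ennreal_mult_less_top)
    show "AE \<theta> in lborel. (\<lambda>N. ennreal (P N \<theta>) * indicator {0..2*pi} \<theta>) \<longlonglongrightarrow>
        ennreal ((norm (\<Sum>n. u n * cis \<theta> ^ n))\<^sup>2 / (2 * pi)) * indicator {0..2*pi} \<theta>"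
      using lim by (intro AE_I2) (auto simp: indicator_def)
  qed auto
  moreover have "(\<lambda>N. \<integral>\<^sup>+\<theta>\<in>{0..2*pi}. ennreal (P N \<theta>) \<partial>lborel) \<longlonglongrightarrow> (\<Sum>n. ennreal ((norm (u n))\<^sup>2))"
    unfolding fin by (intro summable_LIMSEQ) auto
  ultimately show ?thesis by (rule LIMSEQ_unique)
qed

section \<open>Hardy and Bergman norms in terms of Taylor coefficients\<close>

lemma ennpow_mono:
  assumes "x \<le> y" "a > 0"
  shows "ennpow x a \<le> ennpow y a"
proof (cases "y = \<infinity>")
  case False
  hence "x \<noteq> \<infinity>" using assms by (auto simp: top_unique)
  moreover have "enn2real x powr a \<le> enn2real y powr a"
    using assms False by (intro powr_mono2 enn2real_mono) (auto simp: less_top)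
  ultimately show ?thesis using False by (simp add: ennpow_def ennreal_leI)
qed (simp add: ennpow_def)

text \<open>
  On \<open>[0, \<infinity>]\<close> the power is an order isomorphism, which makes it strictly monotone and compatible
  with suprema.
\<close>

lemma ennpow_inverse:
  assumes "a > 0"
  shows "ennpow (ennpow x a) (1/a) = x"
  using assms by (auto simp: ennpow_def powr_powr less_top)

lemma ennpow_le_iff:
  assumes "a > 0"
  shows "ennpow x a \<le> ennpow y a \<longleftrightarrow> x \<le> y"
proof
  assume "ennpow x a \<le> ennpow y a"
  hence "ennpow (ennpow x a) (1/a) \<le> ennpow (ennpow y a) (1/a)"
    using assms by (intro ennpow_mono[where a = "1/a"]) auto
  thus "x \<le> y" using assms by (simp add: ennpow_inverse)
qed (simp add: ennpow_mono assms)

lemma ennpow_ennreal: "x \<ge> 0 \<Longrightarrow> ennpow (ennreal x) a = ennreal (x powr a)"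
  by (simp add: ennpow_def)

lemma SUP_ennpow:
  assumes "a > 0"
  shows "(SUP i\<in>I. ennpow (f i) a) = ennpow (SUP i\<in>I. f i) a"
proof (rule antisym)
  show "(SUP i\<in>I. ennpow (f i) a) \<le> ennpow (SUP i\<in>I. f i) a"
    using assms by (intro SUP_least ennpow_mono SUP_upper) auto
  define S where "S = (SUP i\<in>I. ennpow (f i) a)"
  have "(SUP i\<in>I. f i) \<le> ennpow S (1/a)"
  proof (rule SUP_least)
    fix i assume "i \<in> I"
    hence "ennpow (ennpow (f i) a) (1/a) \<le> ennpow S (1/a)"
      using assms unfolding S_def by (intro ennpow_mono SUP_upper) auto
    thus "f i \<le> ennpow S (1/a)" using assms by (simp add: ennpow_inverse)
  qed
  hence "ennpow (SUP i\<in>I. f i) a \<le> ennpow (ennpow S (1/a)) a" using assms by (intro ennpow_mono)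
  also have "\<dots> = S" using ennpow_inverse[of "1/a" S] assms by simp
  finally show "ennpow (SUP i\<in>I. f i) a \<le> (SUP i\<in>I. ennpow (f i) a)" unfolding S_def .
qed

definition disc_series :: "(nat \<Rightarrow> complex) \<Rightarrow> (complex \<Rightarrow> complex) \<Rightarrow> bool"
  where "disc_series a g \<longleftrightarrow> (\<forall>z\<in>\<bbbD>. (\<lambda>n. a n * z ^ n) sums g z)"

text \<open>
  The squared norm in \<open>A\<^sub>\<beta>\<^sup>2\<close> of the function with Taylor coefficients \<open>a\<close>, where \<open>\<beta> = 1\<close> is the Hardy
  space because then all weights are \<open>1\<close>.
\<close>

definition coeff_energy :: "real \<Rightarrow> (nat \<Rightarrow> complex) \<Rightarrow> ennreal"
  where "coeff_energy \<beta> a = (\<Sum>n. ennreal ((norm (a n))\<^sup>2 * (fact n / pochhammer \<beta> n)))"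

lemma holomorphic_disc_series:
  assumes "g holomorphic_on \<bbbD>"
  shows "disc_series (\<lambda>n. (deriv ^^ n) g 0 / fact n) g"
  unfolding disc_series_def using holomorphic_power_series[OF assms] by auto

lemma disc_series_summable_norm:
  assumes "disc_series a g" "norm z < 1"
  shows "summable (\<lambda>n. norm (a n * z ^ n))"
proof -
  obtain r where r: "norm z < r" "r < 1" using dense[OF assms(2)] by blast
  have r0: "0 \<le> r" using r norm_ge_zero[of z] by linarith
  have "summable (\<lambda>n. a n * (of_real r) ^ n)"
    using assms(1) r r0 unfolding disc_series_def by (auto intro: sums_summable)
  from powser_insidea[OF this, of z] r r0 show ?thesis by simp
qed

lemma disc_series_circle_mean:
  assumes a: "disc_series a g" and z: "norm z < 1"
  shows "(\<integral>\<^sup>+\<theta>\<in>{0..2*pi}. ennreal ((norm (g (z * cis \<theta>)))\<^sup>2 / (2 * pi)) \<partial>lborel)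
     = (\<Sum>n. ennreal ((norm (a n))\<^sup>2 * ((norm z)\<^sup>2) ^ n))"
proof -
  have g: "g (z * cis \<theta>) = (\<Sum>n. a n * z ^ n * cis \<theta> ^ n)" for \<theta>
  proof -
    have "(\<lambda>n. a n * (z * cis \<theta>) ^ n) sums g (z * cis \<theta>)"
      using a z by (auto simp: disc_series_def norm_mult)
    thus ?thesis by (simp add: sums_iff power_mult_distrib mult.assoc)
  qed
  show ?thesis
    unfolding g parseval_circle[OF disc_series_summable_norm[OF a z]]
    unfolding norm_mult norm_power power_mult_distrib power_mult[symmetric] mult.commute[of 2] ..
qed

text \<open>
  The circle means increase with the radius, and every partial sum of the coefficient energy is a
  limit of partial sums of the means.
\<close>

lemma hardy_norm_eq:
  assumes a: "disc_series a g"
  shows "hardy_norm g = ennpow (coeff_energy 1 a) (1/2)"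
proof -
  have mean: "(\<integral>\<^sup>+\<theta>\<in>{0..2*pi}. ennreal (norm (g (of_real r * cis \<theta>)) ^ 2 / (2 * pi)) \<partial>lborel)
     = (\<Sum>n. ennreal ((norm (a n))\<^sup>2 * (r\<^sup>2) ^ n))" if "r \<in> {0<..<1}" for r
  proof -
    have "norm (complex_of_real r) < 1" using that by simp
    from disc_series_circle_mean[OF a this] show ?thesis unfolding norm_of_real power2_abs .
  qed
  have "(SUP r\<in>{0<..<1}. (\<Sum>n. ennreal ((norm (a n))\<^sup>2 * (r\<^sup>2) ^ n))) = (\<Sum>n. ennreal ((norm (a n))\<^sup>2))"
  proof (rule antisym)
    show "(SUP r\<in>{0<..<1}. (\<Sum>n. ennreal ((norm (a n))\<^sup>2 * (r\<^sup>2) ^ n))) \<le> (\<Sum>n. ennreal ((norm (a n))\<^sup>2))"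
    proof (intro SUP_least suminf_le ennreal_leI)
      fix r :: real and n :: nat assume "r \<in> {0<..<1}"
      hence "(r\<^sup>2) ^ n \<le> 1" by (intro power_le_one) auto
      thus "(norm (a n))\<^sup>2 * (r\<^sup>2) ^ n \<le> (norm (a n))\<^sup>2" by (intro mult_left_le) auto
    qed auto
    define S where "S = (SUP r\<in>{0<..<1}. (\<Sum>n. ennreal ((norm (a n))\<^sup>2 * (r\<^sup>2) ^ n)))"
    have "(\<Sum>n<N. ennreal ((norm (a n))\<^sup>2)) \<le> S" for N
    proof (rule tendsto_upperbound)
      have "((\<lambda>r::real. (\<Sum>n<N. ennreal ((norm (a n))\<^sup>2 * (r\<^sup>2) ^ n))) \<longlongrightarrow> (\<Sum>n<N. ennreal ((norm (a n))\<^sup>2 * (1\<^sup>2) ^ n))) (at_left 1)"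
        by (intro tendsto_sum tendsto_ennrealI tendsto_mult tendsto_power tendsto_const tendsto_ident_at)
      thus "((\<lambda>r::real. (\<Sum>n<N. ennreal ((norm (a n))\<^sup>2 * (r\<^sup>2) ^ n))) \<longlongrightarrow> (\<Sum>n<N. ennreal ((norm (a n))\<^sup>2))) (at_left 1)"
        by simp
      have "eventually (\<lambda>r::real. r \<in> {0<..<1}) (at_left 1)"
        by (rule eventually_at_leftI[of 0]) auto
      thus "eventually (\<lambda>r::real. (\<Sum>n<N. ennreal ((norm (a n))\<^sup>2 * (r\<^sup>2) ^ n)) \<le> S) (at_left 1)"
      proof eventually_elim
        case (elim r)
        have "(\<Sum>n<N. ennreal ((norm (a n))\<^sup>2 * (r\<^sup>2) ^ n)) \<le> (\<Sum>n. ennreal ((norm (a n))\<^sup>2 * (r\<^sup>2) ^ n))"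
          by (rule sum_le_suminf) auto
        also have "\<dots> \<le> S" unfolding S_def using elim by (intro SUP_upper)
        finally show ?case .
      qed
    qed simp
    thus "(\<Sum>n. ennreal ((norm (a n))\<^sup>2)) \<le> S" by (intro suminf_le_const) auto
  qed
  also have "\<dots> = coeff_energy 1 a"
    unfolding coeff_energy_def pochhammer_fact[symmetric] by simp
  also have "(SUP r\<in>{0<..<1}. (\<Sum>n. ennreal ((norm (a n))\<^sup>2 * (r\<^sup>2) ^ n))) =
     (SUP r\<in>{0<..<1}. \<integral>\<^sup>+\<theta>\<in>{0..2*pi}. ennreal (norm (g (of_real r * cis \<theta>)) ^ 2 / (2 * pi)) \<partial>lborel)"
    by (rule SUP_cong) (simp_all only: mean)
  finally show ?thesis
    unfolding hardy_norm_def by (subst SUP_ennpow) simp_all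
qed

text \<open>
  After averaging over circles and Parseval, the integrand is a series of monomials in the squared
  modulus, and each of them is a Beta integral.
\<close>

lemma bergman_integral_eq:
  assumes g: "g holomorphic_on \<bbbD>" and a: "disc_series a g" and b: "\<beta> > 1"
  shows "(\<integral>\<^sup>+z\<in>\<bbbD>. ennreal ((norm (g z))\<^sup>2 * (\<beta> - 1) * (1 - (norm z)\<^sup>2) powr (\<beta> - 2) / pi) \<partial>lborel) = coeff_energy \<beta> a"
proof -
  define w where "w = (\<lambda>t. (\<beta> - 1) * (1 - t) powr (\<beta> - 2))"
  have w0: "w t \<ge> 0" for t using b by (simp add: w_def)
  have [measurable]: "w \<in> borel_measurable borel" unfolding w_def by measurable
  have [measurable]: "(\<lambda>z. indicator \<bbbD> z *\<^sub>R g z) \<in> borel_measurable borel"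
    by (intro borel_measurable_continuous_on_indicator holomorphic_on_imp_continuous_on g) auto
  define q where "q = (\<lambda>z. ennreal ((norm (indicator \<bbbD> z *\<^sub>R g z))\<^sup>2 * w ((norm z)\<^sup>2) / pi))"
  have [measurable]: "q \<in> borel_measurable borel" unfolding q_def by measurable
  have q: "q z = ennreal ((norm (g z))\<^sup>2 * w ((norm z)\<^sup>2) / pi) * indicator \<bbbD> z" for z
    by (simp add: q_def indicator_def)
  have [measurable]: "(\<lambda>z. ennreal (((norm z)\<^sup>2) ^ n * w ((norm z)\<^sup>2) / pi) * indicator \<bbbD> z) \<in> borel_measurable (borel :: complex measure)" for n
  proof -
    have [measurable]: "(\<lambda>z::complex. w ((norm z)\<^sup>2)) \<in> borel_measurable borel"
      by (rule measurable_compose[of _ _ borel]) measurable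
    have [measurable]: "\<bbbD> \<in> sets borel" by (rule borel_open) simp
    have "(\<lambda>z. ennreal (((norm z)\<^sup>2) ^ n * w ((norm z)\<^sup>2) / pi)) \<in> borel_measurable (borel :: complex measure)"
      by measurable
    thus ?thesis by (rule borel_measurable_times_ennreal) (rule borel_measurable_indicator, fact)
  qed
  have inner: "(\<integral>\<^sup>+\<theta>\<in>{0..2*pi}. q (z * cis \<theta>) * ennreal (1 / (2 * pi)) \<partial>lborel)
     = (\<Sum>n. ennreal ((norm (a n))\<^sup>2) * (ennreal (((norm z)\<^sup>2) ^ n * w ((norm z)\<^sup>2) / pi) * indicator \<bbbD> z))" for z
  proof (cases "z \<in> \<bbbD>")
    case True
    have cg: "continuous_on {0..2*pi} (\<lambda>\<theta>. g (z * cis \<theta>))"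
      using True by (intro continuous_on_compose2[OF holomorphic_on_imp_continuous_on[OF g]] continuous_intros) (auto simp: norm_mult)
    have m[measurable]: "(\<lambda>\<theta>. indicator {0..2*pi} \<theta> *\<^sub>R g (z * cis \<theta>)) \<in> borel_measurable borel"
      by (intro borel_measurable_continuous_on_indicator cg) auto
    have "(\<lambda>\<theta>. ennreal ((norm (indicator {0..2*pi} \<theta> *\<^sub>R g (z * cis \<theta>)))\<^sup>2 / (2 * pi))) \<in> borel_measurable borel"
      by measurable
    also have "(\<lambda>\<theta>. ennreal ((norm (indicator {0..2*pi} \<theta> *\<^sub>R g (z * cis \<theta>)))\<^sup>2 / (2 * pi))) =
        (\<lambda>\<theta>. ennreal ((norm (g (z * cis \<theta>)))\<^sup>2 / (2 * pi)) * indicator {0..2*pi} \<theta>)"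
      by (auto simp: indicator_def)
    finally have meas: "(\<lambda>\<theta>. ennreal ((norm (g (z * cis \<theta>)))\<^sup>2 / (2 * pi)) * indicator {0..2*pi} \<theta>) \<in> borel_measurable lborel" by simp
    have "(\<integral>\<^sup>+\<theta>\<in>{0..2*pi}. q (z * cis \<theta>) * ennreal (1 / (2 * pi)) \<partial>lborel)
        = (\<integral>\<^sup>+\<theta>. ennreal ((norm (g (z * cis \<theta>)))\<^sup>2 / (2 * pi)) * indicator {0..2*pi} \<theta> * ennreal (w ((norm z)\<^sup>2) / pi) \<partial>lborel)"
      using True w0 by (intro nn_integral_cong) (auto simp: q norm_mult indicator_def simp flip: ennreal_mult)
    also have "\<dots> = (\<integral>\<^sup>+\<theta>\<in>{0..2*pi}. ennreal ((norm (g (z * cis \<theta>)))\<^sup>2 / (2 * pi)) \<partial>lborel) * ennreal (w ((norm z)\<^sup>2) / pi)"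
      by (rule nn_integral_multc[OF meas])
    also have "\<dots> = (\<Sum>n. ennreal ((norm (a n))\<^sup>2 * ((norm z)\<^sup>2) ^ n) * ennreal (w ((norm z)\<^sup>2) / pi))"
      using True by (subst disc_series_circle_mean[OF a]) (auto simp: ennreal_suminf_multc)
    also have "\<dots> = (\<Sum>n. ennreal ((norm (a n))\<^sup>2) * (ennreal (((norm z)\<^sup>2) ^ n * w ((norm z)\<^sup>2) / pi) * indicator \<bbbD> z))"
      using True w0 by (intro suminf_cong) (simp add: mult.assoc flip: ennreal_mult)
    finally show ?thesis .
  next
    case False
    thus ?thesis by (simp add: q norm_mult)
  qed
  have "(\<integral>\<^sup>+z\<in>\<bbbD>. ennreal ((norm (g z))\<^sup>2 * (\<beta> - 1) * (1 - (norm z)\<^sup>2) powr (\<beta> - 2) / pi) \<partial>lborel) = (\<integral>\<^sup>+z. q z \<partial>lborel)"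
    by (simp add: q w_def mult.assoc)
  also have "\<dots> = (\<integral>\<^sup>+z. (\<Sum>n. ennreal ((norm (a n))\<^sup>2) * (ennreal (((norm z)\<^sup>2) ^ n * w ((norm z)\<^sup>2) / pi) * indicator \<bbbD> z)) \<partial>lborel)"
    by (subst nn_integral_circle_average) (simp_all add: inner)
  also have "\<dots> = (\<Sum>n. ennreal ((norm (a n))\<^sup>2) * (\<integral>\<^sup>+z\<in>\<bbbD>. ennreal (((norm z)\<^sup>2) ^ n * w ((norm z)\<^sup>2) / pi) \<partial>lborel))"
    by (subst nn_integral_suminf) (simp_all add: nn_integral_cmult)
  also have "\<dots> = coeff_energy \<beta> a"
    unfolding coeff_energy_def
  proof (intro suminf_cong)
    fix n
    have "(\<integral>\<^sup>+z\<in>\<bbbD>. ennreal (((norm z)\<^sup>2) ^ n * w ((norm z)\<^sup>2) / pi) \<partial>lborel)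
       = ennreal pi * (\<integral>\<^sup>+t\<in>{0..<1}. ennreal (t ^ n * w t / pi) \<partial>lborel)"
      by (rule nn_integral_disc_radial) measurable
    also have "\<dots> = (\<integral>\<^sup>+t. ennreal pi * (ennreal (t ^ n * w t / pi) * indicator {0..<1} t) \<partial>lborel)"
      by (rule nn_integral_cmult[symmetric]) measurable
    also have "\<dots> = (\<integral>\<^sup>+t\<in>{0..<1}. ennreal (t ^ n * w t) \<partial>lborel)"
      using w0 by (intro nn_integral_cong) (auto simp: indicator_def simp flip: ennreal_mult)
    also have "\<dots> = ennreal (fact n / pochhammer \<beta> n)"
      unfolding w_def by (rule nn_integral_monomial_weight[OF b])
    finally show "ennreal ((norm (a n))\<^sup>2) * (\<integral>\<^sup>+z\<in>\<bbbD>. ennreal (((norm z)\<^sup>2) ^ n * w ((norm z)\<^sup>2) / pi) \<partial>lborel)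
      = ennreal ((norm (a n))\<^sup>2 * (fact n / pochhammer \<beta> n))"
      using b by (simp add: pochhammer_nonneg flip: ennreal_mult)
  qed
  finally show ?thesis .
qed

section \<open>Interpolation by two reproducing kernels\<close>

definition kernel_coeff :: "complex \<Rightarrow> real \<Rightarrow> nat \<Rightarrow> complex"
  where "kernel_coeff w \<beta> n = of_real (pochhammer \<beta> n / fact n) * cnj w ^ n"

lemma disc_series_kernel:
  assumes "w \<in> \<bbbD>"
  shows "disc_series (kernel_coeff w \<beta>) (disc_kernel w \<beta>)"
  unfolding disc_series_def
proof
  fix z :: complex assume z: "z \<in> \<bbbD>"
  define u where "u = - (cnj w * z)"
  have "norm w * norm z < 1 * 1" using assms z by (intro mult_strict_mono) auto
  hence u: "norm u < 1" by (simp add: u_def norm_mult)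
  have "(\<lambda>n. ((- complex_of_real \<beta>) gchoose n) * u ^ n) sums (1 + u) powr (- complex_of_real \<beta>)"
    by (rule gen_binomial_complex[OF u])
  also have "(\<lambda>n. ((- complex_of_real \<beta>) gchoose n) * u ^ n) = (\<lambda>n. kernel_coeff w \<beta> n * z ^ n)"
  proof
    fix n
    have "((- complex_of_real \<beta>) gchoose n) * u ^ n = (pochhammer (complex_of_real \<beta>) n / fact n) * ((-1) ^ n * u ^ n)"
      by (simp add: gbinomial_pochhammer)
    also have "(-1) ^ n * u ^ n = (cnj w * z) ^ n"
      by (simp add: u_def flip: power_mult_distrib)
    also have "pochhammer (complex_of_real \<beta>) n = of_real (pochhammer \<beta> n)"
      by (rule pochhammer_of_real)
    finally show "((- complex_of_real \<beta>) gchoose n) * u ^ n = kernel_coeff w \<beta> n * z ^ n"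
      by (simp add: kernel_coeff_def power_mult_distrib)
  qed
  also have "(1 + u) powr (- complex_of_real \<beta>) = disc_kernel w \<beta> z"
    by (simp add: disc_kernel_def u_def powr_minus_divide)
  finally show "(\<lambda>n. kernel_coeff w \<beta> n * z ^ n) sums disc_kernel w \<beta> z" .
qed

definition two_kernel_coeff where
  "two_kernel_coeff \<beta> d1 w1 d2 w2 n = d1 * kernel_coeff w1 \<beta> n + d2 * kernel_coeff w2 \<beta> n"

lemma disc_series_two_kernel:
  assumes "w1 \<in> \<bbbD>" "w2 \<in> \<bbbD>"
  shows "disc_series (two_kernel_coeff \<beta> d1 w1 d2 w2) (\<lambda>z. d1 * disc_kernel w1 \<beta> z + d2 * disc_kernel w2 \<beta> z)"
  unfolding disc_series_def two_kernel_coeff_def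
proof
  fix z assume z: "z \<in> \<bbbD>"
  have 1: "(\<lambda>n. kernel_coeff w \<beta> n * z ^ n) sums disc_kernel w \<beta> z" if "w \<in> \<bbbD>" for w
    using disc_series_kernel[OF that, of \<beta>] z by (simp add: disc_series_def)
  have "(\<lambda>n. d1 * (kernel_coeff w1 \<beta> n * z ^ n) + d2 * (kernel_coeff w2 \<beta> n * z ^ n)) sums
     (d1 * disc_kernel w1 \<beta> z + d2 * disc_kernel w2 \<beta> z)"
    by (intro sums_add sums_mult 1 assms)
  thus "(\<lambda>n. (d1 * kernel_coeff w1 \<beta> n + d2 * kernel_coeff w2 \<beta> n) * z ^ n) sums
     (d1 * disc_kernel w1 \<beta> z + d2 * disc_kernel w2 \<beta> z)"
    by (simp add: algebra_simps)
qed

text \<open>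
  The reproducing property in coefficients: the weight of the inner product cancels the binomial
  coefficient of the kernel, and what is left is the Taylor series at \<open>w1\<close> and \<open>w2\<close>.
\<close>

lemma reproducing_two_kernel:
  assumes a: "disc_series a g" and w: "w1 \<in> \<bbbD>" "w2 \<in> \<bbbD>" and b: "\<beta> > 0"
  shows "(\<lambda>n. a n * cnj (two_kernel_coeff \<beta> d1 w1 d2 w2 n) * of_real (fact n / pochhammer \<beta> n)) sums
     (cnj d1 * g w1 + cnj d2 * g w2)"
proof -
  have "(\<lambda>n. cnj d1 * (a n * w1 ^ n) + cnj d2 * (a n * w2 ^ n)) sums (cnj d1 * g w1 + cnj d2 * g w2)"
    using a w by (intro sums_add sums_mult) (auto simp: disc_series_def)
  also have "(\<lambda>n. cnj d1 * (a n * w1 ^ n) + cnj d2 * (a n * w2 ^ n)) =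
     (\<lambda>n. a n * cnj (two_kernel_coeff \<beta> d1 w1 d2 w2 n) * of_real (fact n / pochhammer \<beta> n))"
  proof
    fix n
    have p: "pochhammer \<beta> n \<noteq> 0" using pochhammer_pos[OF b, of n] by simp
    have "cnj (kernel_coeff w \<beta> n) * of_real (fact n / pochhammer \<beta> n) = w ^ n" for w
      using p by (simp add: kernel_coeff_def)
    hence "a n * cnj d1 * w1 ^ n + a n * cnj d2 * w2 ^ n =
      a n * cnj d1 * (cnj (kernel_coeff w1 \<beta> n) * of_real (fact n / pochhammer \<beta> n)) +
      a n * cnj d2 * (cnj (kernel_coeff w2 \<beta> n) * of_real (fact n / pochhammer \<beta> n))" by (simp only:)
    thus "cnj d1 * (a n * w1 ^ n) + cnj d2 * (a n * w2 ^ n) = 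
      a n * cnj (two_kernel_coeff \<beta> d1 w1 d2 w2 n) * of_real (fact n / pochhammer \<beta> n)"
      by (simp only: two_kernel_coeff_def complex_cnj_add complex_cnj_mult distrib_left distrib_right mult_ac)
  qed
  finally show ?thesis .
qed

lemma coeff_energy_two_kernel:
  assumes w: "w1 \<in> \<bbbD>" "w2 \<in> \<bbbD>" and b: "\<beta> > 0"
    and k: "k = (\<lambda>z. d1 * disc_kernel w1 \<beta> z + d2 * disc_kernel w2 \<beta> z)"
  shows "coeff_energy \<beta> (two_kernel_coeff \<beta> d1 w1 d2 w2) = ennreal (Re (cnj d1 * k w1 + cnj d2 * k w2))"
    and "(\<lambda>n. (norm (two_kernel_coeff \<beta> d1 w1 d2 w2 n))\<^sup>2 * (fact n / pochhammer \<beta> n)) sums Re (cnj d1 * k w1 + cnj d2 * k w2)"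
proof -
  define c where "c = two_kernel_coeff \<beta> d1 w1 d2 w2"
  have "disc_series c k" unfolding c_def k by (rule disc_series_two_kernel[OF w])
  from reproducing_two_kernel[OF this w b, of d1 d2]
  have "(\<lambda>n. Re (c n * cnj (c n) * of_real (fact n / pochhammer \<beta> n))) sums Re (cnj d1 * k w1 + cnj d2 * k w2)"
    unfolding c_def by (rule sums_Re)
  also have "(\<lambda>n. Re (c n * cnj (c n) * of_real (fact n / pochhammer \<beta> n))) = (\<lambda>n. (norm (c n))\<^sup>2 * (fact n / pochhammer \<beta> n))"
  proof
    fix n
    have "c n * cnj (c n) * of_real (fact n / pochhammer \<beta> n) = of_real ((norm (c n))\<^sup>2 * (fact n / pochhammer \<beta> n))"
      by (simp only: complex_norm_square of_real_mult)
    thus "Re (c n * cnj (c n) * of_real (fact n / pochhammer \<beta> n)) = (norm (c n))\<^sup>2 * (fact n / pochhammer \<beta> n)"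
      by (simp only: Re_complex_of_real)
  qed
  finally show s: "(\<lambda>n. (norm (two_kernel_coeff \<beta> d1 w1 d2 w2 n))\<^sup>2 * (fact n / pochhammer \<beta> n)) sums Re (cnj d1 * k w1 + cnj d2 * k w2)"
    unfolding c_def .
  have "0 \<le> (norm (two_kernel_coeff \<beta> d1 w1 d2 w2 n))\<^sup>2 * (fact n / pochhammer \<beta> n)" for n
    using pochhammer_pos[OF b, of n] by simp
  from suminf_ennreal_eq[OF this s]
  show "coeff_energy \<beta> (two_kernel_coeff \<beta> d1 w1 d2 w2) = ennreal (Re (cnj d1 * k w1 + cnj d2 * k w2))"
    unfolding coeff_energy_def .
qed

text \<open>
  Termwise \<open>\<bar>a n\<bar>\<^sup>2 \<ge> 2 * Re (a n * cnj (c n)) - \<bar>c n\<bar>\<^sup>2\<close>, where \<open>c\<close> belongs to the interpolant.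
  By the reproducing property the inner product of \<open>g\<close> with the interpolant is the squared norm of the latter. Arguing
  termwise covers also the case that the energy of \<open>g\<close> is infinite.
\<close>

lemma coeff_energy_ge_interpolant:
  assumes a: "disc_series a g" and w: "w1 \<in> \<bbbD>" "w2 \<in> \<bbbD>" and b: "\<beta> > 0"
    and k: "k = (\<lambda>z. d1 * disc_kernel w1 \<beta> z + d2 * disc_kernel w2 \<beta> z)"
    and interp: "k w1 = g w1" "k w2 = g w2"
  shows "ennreal (Re (cnj d1 * g w1 + cnj d2 * g w2)) \<le> coeff_energy \<beta> a"
proof -
  define c where "c = two_kernel_coeff \<beta> d1 w1 d2 w2"
  define m where "m = (\<lambda>n. fact n / pochhammer \<beta> n :: real)"
  define X where "X = Re (cnj d1 * g w1 + cnj d2 * g w2)"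
  have m: "m n \<ge> 0" for n using pochhammer_pos[OF b, of n] by (simp add: m_def)
  have 1: "(\<lambda>n. (norm (c n))\<^sup>2 * m n) sums X"
    using coeff_energy_two_kernel(2)[OF w b k] unfolding X_def c_def m_def interp .
  have 2: "(\<lambda>n. Re (a n * cnj (c n) * of_real (m n))) sums X"
    unfolding X_def c_def m_def by (rule sums_Re[OF reproducing_two_kernel[OF a w b]])
  have "(\<lambda>n. 2 * Re (a n * cnj (c n) * of_real (m n)) - (norm (c n))\<^sup>2 * m n) sums (2 * X - X)"
    by (intro sums_diff sums_mult 1 2)
  hence lim: "(\<lambda>N. ennreal (\<Sum>n<N. 2 * Re (a n * cnj (c n) * of_real (m n)) - (norm (c n))\<^sup>2 * m n)) \<longlonglongrightarrow> ennreal X"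
    unfolding sums_def by (intro tendsto_ennrealI) simp
  have "ennreal (\<Sum>n<N. 2 * Re (a n * cnj (c n) * of_real (m n)) - (norm (c n))\<^sup>2 * m n) \<le> coeff_energy \<beta> a" for N
  proof -
    have "2 * Re (a n * cnj (c n) * of_real (m n)) - (norm (c n))\<^sup>2 * m n \<le> (norm (a n))\<^sup>2 * m n" for n
    proof -
      have "0 \<le> (norm (a n + - c n))\<^sup>2" by simp
      also have "\<dots> = (norm (a n))\<^sup>2 + (norm (c n))\<^sup>2 - 2 * Re (a n * cnj (c n))"
        by (subst norm_add_square_complex) simp
      finally have "2 * Re (a n * cnj (c n)) - (norm (c n))\<^sup>2 \<le> (norm (a n))\<^sup>2" by simp
      hence "(2 * Re (a n * cnj (c n)) - (norm (c n))\<^sup>2) * m n \<le> (norm (a n))\<^sup>2 * m n"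
        by (rule mult_right_mono[OF _ m])
      moreover have "Re (a n * cnj (c n) * of_real (m n)) = Re (a n * cnj (c n)) * m n"
        using times_complex.sel(1)[of "a n * cnj (c n)" "of_real (m n)"] by simp
      ultimately show ?thesis by (simp only: left_diff_distrib mult.assoc)
    qed
    hence "ennreal (\<Sum>n<N. 2 * Re (a n * cnj (c n) * of_real (m n)) - (norm (c n))\<^sup>2 * m n) \<le> ennreal (\<Sum>n<N. (norm (a n))\<^sup>2 * m n)"
      by (intro ennreal_leI sum_mono)
    also have "\<dots> = (\<Sum>n<N. ennreal ((norm (a n))\<^sup>2 * m n))"
      using m by (intro sum_ennreal[symmetric]) simp
    also have "\<dots> \<le> coeff_energy \<beta> a" unfolding coeff_energy_def m_def by (rule sum_le_suminf) auto
    finally show ?thesis .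
  qed
  thus ?thesis unfolding X_def[symmetric] by (intro LIMSEQ_le_const2[OF lim]) auto
qed

section \<open>The phase of a zero-free combination of two kernels\<close>

lemma one_minus_cnj_mult_Re_pos:
  assumes "w \<in> \<bbbD>" "z \<in> \<bbbD>"
  shows "Re (1 - cnj w * z) > 0"
proof -
  have "Re (cnj w * z) \<le> norm (cnj w * z)" by (rule complex_Re_le_cmod)
  also have "\<dots> < 1 * 1" unfolding norm_mult using assms by (intro mult_strict_mono) auto
  finally show ?thesis by simp
qed

lemma norm_one_minus_cnj_mult:
  "(norm (1 - cnj w * z))\<^sup>2 = (1 - (norm w)\<^sup>2) * (1 - (norm z)\<^sup>2) + (norm (w - z))\<^sup>2"
  unfolding cmod_power2 by (simp add: power2_eq_square algebra_simps)

lemma norm_square_diff_cnj: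
  fixes \<mu> :: complex
  shows "(norm (\<mu> * cnj w2 - cnj w1))\<^sup>2 - (norm (\<mu> - 1))\<^sup>2
     = 2 * Re (\<mu> * cnj (1 - cnj w1 * w2)) - (norm \<mu>)\<^sup>2 * (1 - (norm w2)\<^sup>2) - (1 - (norm w1)\<^sup>2)"
  unfolding cmod_power2 by (simp add: power2_eq_square algebra_simps)

text \<open>
  The Moebius map \<open>z \<mapsto> (1 - cnj w1 * z) / (1 - cnj w2 * z)\<close> sends the disc to a disc. The points
  \<open>w1\<close> and \<open>w2\<close> go to two points of the ray through \<open>k\<close>, so the segment between these, parametrized by
  \<open>l\<close>, is the image of points of the disc. These are the points \<open>z\<close>.
\<close>

lemma geodesic_point:
  fixes w1 w2 k :: complex and l :: real
  assumes w: "w1 \<in> \<bbbD>" "w2 \<in> \<bbbD>" "w1 \<noteq> w2"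
  defines "k \<equiv> 1 - cnj w1 * w2"
  assumes l: "(1 - (norm w1)\<^sup>2) / (norm k)\<^sup>2 \<le> l" "l \<le> 1 / (1 - (norm w2)\<^sup>2)"
  defines "z \<equiv> (of_real l * k - 1) / (of_real l * k * cnj w2 - cnj w1)"
  shows "of_real l * k * cnj w2 - cnj w1 \<noteq> 0" and "z \<in> \<bbbD>"
    and "1 - cnj w1 * z = of_real l * k * (1 - cnj w2 * z)"
    and "l > 0"
proof -
  have a1: "1 - (norm w1)\<^sup>2 > 0" and a2: "1 - (norm w2)\<^sup>2 > 0"
    using w by (auto simp: abs_square_less_1)
  have kk: "(norm k)\<^sup>2 = (1 - (norm w1)\<^sup>2) * (1 - (norm w2)\<^sup>2) + (norm (w1 - w2))\<^sup>2"
    unfolding k_def by (rule norm_one_minus_cnj_mult)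
  have k2: "(norm k)\<^sup>2 > (1 - (norm w1)\<^sup>2) * (1 - (norm w2)\<^sup>2)" unfolding kk using w by simp
  have kp: "(norm k)\<^sup>2 > 0" using k2 mult_pos_pos[OF a1 a2] by linarith
  show l0: "l > 0" using l(1) divide_pos_pos[OF a1 kp] by linarith
  have l1: "(1 - (norm w1)\<^sup>2) \<le> l * (norm k)\<^sup>2" using l(1) kp by (simp add: pos_divide_le_eq)
  have l2: "l * (1 - (norm w2)\<^sup>2) \<le> 1" using l(2) a2 by (simp add: pos_le_divide_eq)
  have Q: "2 * l * (norm k)\<^sup>2 - l\<^sup>2 * (norm k)\<^sup>2 * (1 - (norm w2)\<^sup>2) - (1 - (norm w1)\<^sup>2) > 0"
  proof -
    have e: "2 * l * (norm k)\<^sup>2 - l\<^sup>2 * (norm k)\<^sup>2 * (1 - (norm w2)\<^sup>2) - (1 - (norm w1)\<^sup>2)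
      = l * (norm k)\<^sup>2 * (1 - l * (1 - (norm w2)\<^sup>2)) + (l * (norm k)\<^sup>2 - (1 - (norm w1)\<^sup>2))"
      by (simp add: algebra_simps power2_eq_square)
    show ?thesis
    proof (cases "l * (1 - (norm w2)\<^sup>2) < 1")
      case True
      hence "l * (norm k)\<^sup>2 * (1 - l * (1 - (norm w2)\<^sup>2)) > 0" using l0 kp by simp
      thus ?thesis unfolding e using l1 by linarith
    next
      case False
      hence eq: "l * (1 - (norm w2)\<^sup>2) = 1" using l2 by simp
      have "l * ((1 - (norm w1)\<^sup>2) * (1 - (norm w2)\<^sup>2)) < l * (norm k)\<^sup>2" using k2 l0 by simp
      also have "l * ((1 - (norm w1)\<^sup>2) * (1 - (norm w2)\<^sup>2)) = (1 - (norm w1)\<^sup>2) * (l * (1 - (norm w2)\<^sup>2))" by (simp only: mult_ac)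
      finally show ?thesis unfolding e eq by simp
    qed
  qed
  have d: "(norm (of_real l * k * cnj w2 - cnj w1))\<^sup>2 - (norm (of_real l * k - 1))\<^sup>2 > 0"
  proof -
    have "of_real l * k * cnj k = of_real (l * (norm k)\<^sup>2)"
      by (simp only: mult.assoc complex_norm_square[symmetric] of_real_mult)
    hence "Re (of_real l * k * cnj (1 - cnj w1 * w2)) = l * (norm k)\<^sup>2" unfolding k_def[symmetric] by (simp only: Re_complex_of_real)
    moreover have "(norm (of_real l * k))\<^sup>2 = l\<^sup>2 * (norm k)\<^sup>2" by (simp add: norm_mult power_mult_distrib)
    ultimately show ?thesis unfolding norm_square_diff_cnj using Q by simp
  qed
  show nz: "of_real l * k * cnj w2 - cnj w1 \<noteq> 0"
  proof
    assume "of_real l * k * cnj w2 - cnj w1 = 0"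
    with d show False by simp
  qed
  have "norm (of_real l * k - 1) < norm (of_real l * k * cnj w2 - cnj w1)"
    by (rule power_less_imp_less_base[where n = 2]) (use d in simp_all)
  thus "z \<in> \<bbbD>" using nz by (simp add: z_def norm_divide)
  have "z * (of_real l * k * cnj w2 - cnj w1) = of_real l * k - 1" unfolding z_def using nz by simp
  thus "1 - cnj w1 * z = of_real l * k * (1 - cnj w2 * z)" by (simp add: algebra_simps)
qed

text \<open>
  If the argument changed by \<open>pi\<close> or more, it would change by exactly \<open>pi\<close> at some parameter, and then the
  origin would lie between two points of the segment, against the fact that \<open>exp\<close> has no zeros.
\<close>

lemma Im_log_segment_less_pi:
  fixes Y :: "real \<Rightarrow> complex" and \<sigma> :: "real \<Rightarrow> real"
  assumes ab: "a \<le> b" and Y: "continuous_on {a..b} Y" and s: "continuous_on {a..b} \<sigma>"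
    and exp: "\<And>l. l \<in> {a..b} \<Longrightarrow> exp (Y l) = c + d * of_real (\<sigma> l)"
  shows "\<bar>Im (Y b) - Im (Y a)\<bar> < pi"
proof (rule ccontr)
  assume "\<not> \<bar>Im (Y b) - Im (Y a)\<bar> < pi"
  hence "\<exists>l. a \<le> l \<and> l \<le> b \<and> \<bar>Im (Y l) - Im (Y a)\<bar> = pi"
    using ab by (intro IVT'[where f = "\<lambda>l. \<bar>Im (Y l) - Im (Y a)\<bar>"] continuous_intros Y) auto
  then obtain l where l: "l \<in> {a..b}" "\<bar>Im (Y l) - Im (Y a)\<bar> = pi" by auto
  define r where "r = exp (Re (Y l - Y a))"
  have r: "r > 0" by (simp add: r_def)
  have "exp (Y l - Y a) = - of_real r"
  proof -
    have "Im (Y l - Y a) = pi \<or> Im (Y l - Y a) = - pi" using l(2) by (auto simp: abs_if split: if_splits)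
    thus ?thesis unfolding exp_eq_polar[of "Y l - Y a"] r_def
      by (auto simp: exp_of_real complex_eq_iff)
  qed
  hence "exp (Y l) = - of_real r * exp (Y a)" by (simp add: exp_diff field_simps)
  hence e: "c + d * of_real (\<sigma> l) = - of_real r * (c + d * of_real (\<sigma> a))"
    using exp l(1) ab by simp
  (* The value of sigma at which the affine function vanishes. *)
  define t where "t = (\<sigma> l + r * \<sigma> a) / (1 + r)"
  have "\<exists>l'\<in>{a..l}. \<sigma> l' = t"
  proof -
    have cl: "continuous_on {a..l} \<sigma>" using s l by (auto intro: continuous_on_subset)
    show ?thesis
    proof (cases "\<sigma> a \<le> \<sigma> l")
      case True
      have "\<sigma> a \<le> t" "t \<le> \<sigma> l" unfolding t_def using r True
        by (simp_all add: pos_le_divide_eq pos_divide_le_eq algebra_simps)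
      thus ?thesis using IVT'[of \<sigma> a t l] cl l by auto
    next
      case False
      hence "\<sigma> l \<le> t" "t \<le> \<sigma> a" unfolding t_def using r False
        by (simp_all add: pos_le_divide_eq pos_divide_le_eq algebra_simps)
      thus ?thesis using IVT2'[of \<sigma> l t a] cl l by auto
    qed
  qed
  then obtain l' where "l' \<in> {a..l}" and l'2: "\<sigma> l' = t" by blast
  hence l'1: "l' \<in> {a..b}" using l(1) by simp
  have "(c + d * of_real t) * of_real (1 + r) = c + d * of_real (\<sigma> l) + of_real r * (c + d * of_real (\<sigma> a))"
  proof -
    have "of_real t * of_real (1 + r) = (of_real (\<sigma> l + r * \<sigma> a) :: complex)"
      unfolding of_real_mult[symmetric] t_def using r by simp
    hence "d * of_real t * of_real (1 + r) = d * (of_real (\<sigma> l + r * \<sigma> a) :: complex)"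
      by (simp only: mult.assoc)
    thus ?thesis by (simp add: algebra_simps)
  qed
  also have "\<dots> = 0" unfolding e by simp
  finally have "c + d * of_real t = 0" using r
    by (metis add_pos_pos less_irrefl mult_eq_0_iff of_real_eq_0_iff zero_less_one)
  with exp[OF l'1] l'2 show False by simp
qed

lemma disc_kernel_exp:
  assumes "w \<in> \<bbbD>" "z \<in> \<bbbD>"
  shows "disc_kernel w \<beta> z = exp (- of_real \<beta> * Ln (1 - cnj w * z))"
proof -
  have "1 - cnj w * z \<noteq> 0" using one_minus_cnj_mult_Re_pos[OF assms] by (metis less_irrefl zero_complex.sel(1))
  thus ?thesis by (simp add: disc_kernel_def powr_def exp_minus field_simps)
qed

text \<open>
  On the geodesic the two kernels differ by the factor \<open>(l * k)\<close> to the power \<open>\<alpha>\<close>, which has constant phase. So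
  \<open>exp (\<alpha> * h)\<close> divided by the first kernel moves on a line as \<open>l\<close> varies, and its logarithm
  \<open>Y\<close> can be followed continuously because the branch \<open>h\<close> is defined on the whole disc.
\<close>

lemma phase_bound:
  assumes h: "h holomorphic_on \<bbbD>" and w: "w1 \<in> \<bbbD>" "w2 \<in> \<bbbD>" "w1 \<noteq> w2" and al: "\<alpha> > 0"
    and G: "\<And>z. z \<in> \<bbbD> \<Longrightarrow> exp (of_real \<alpha> * h z) = c1 * disc_kernel w1 \<alpha> z + c2 * disc_kernel w2 \<alpha> z"
  shows "\<alpha> * \<bar>Im (h w1) - Im (h w2) - Im (Ln (1 - cnj w1 * w2))\<bar> < pi"
proof -
  define k where "k = 1 - cnj w1 * w2"
  define l1 where "l1 = (1 - (norm w1)\<^sup>2) / (norm k)\<^sup>2"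
  define l2 where "l2 = 1 / (1 - (norm w2)\<^sup>2)"
  have a1: "1 - (norm w1)\<^sup>2 > 0" and a2: "1 - (norm w2)\<^sup>2 > 0"
    using w by (auto simp: abs_square_less_1)
  have kre: "Re k > 0" unfolding k_def by (rule one_minus_cnj_mult_Re_pos[OF w(1,2)])
  hence k0: "k \<noteq> 0" by auto
  have kp: "(norm k)\<^sup>2 > 0" using k0 by simp
  have "(1 - (norm w1)\<^sup>2) * (1 - (norm w2)\<^sup>2) \<le> (norm k)\<^sup>2"
    unfolding k_def norm_one_minus_cnj_mult by simp
  hence l12: "l1 \<le> l2" unfolding l1_def l2_def using kp a2 by (simp add: divide_simps)
  define z where "z = (\<lambda>l. (of_real l * k - 1) / (of_real l * k * cnj w2 - cnj w1))"
  have zD: "of_real l * k * cnj w2 - cnj w1 \<noteq> 0" "z l \<in> \<bbbD>"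
    "1 - cnj w1 * z l = of_real l * k * (1 - cnj w2 * z l)" "l > 0" if "l \<in> {l1..l2}" for l
    using geodesic_point[OF w, of l] that unfolding z_def k_def l1_def l2_def by auto
  have z1: "z l1 = w1"
  proof -
    have "of_real l1 * k * cnj k = 1 - cnj w1 * w1"
    proof -
      have "of_real l1 * (k * cnj k) = of_real (l1 * (norm k)\<^sup>2)"
        by (simp only: complex_norm_square[symmetric] of_real_mult)
      also have "l1 * (norm k)\<^sup>2 = 1 - (norm w1)\<^sup>2" using kp by (simp add: l1_def)
      also have "of_real (1 - (norm w1)\<^sup>2) = 1 - cnj w1 * w1" 
        by (simp only: of_real_diff of_real_1 complex_norm_square mult.commute)
      finally show ?thesis by (simp only: mult.assoc)
    qed
    hence "of_real l1 * k - 1 = w1 * (of_real l1 * k * cnj w2 - cnj w1)" by (simp add: k_def algebra_simps)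
    thus ?thesis using zD(1)[of l1] l12 by (simp add: z_def)
  qed
  have z2: "z l2 = w2"
  proof -
    have "of_real l2 * (1 - cnj w2 * w2) = (1::complex)"
    proof -
      have "1 - cnj w2 * w2 = of_real (1 - (norm w2)\<^sup>2)"
        by (simp only: of_real_diff of_real_1 complex_norm_square mult.commute)
      hence "of_real l2 * (1 - cnj w2 * w2) = of_real (l2 * (1 - (norm w2)\<^sup>2))" by (simp only: of_real_mult)
      also have "l2 * (1 - (norm w2)\<^sup>2) = 1" using a2 by (simp add: l2_def)
      finally show ?thesis by simp
    qed
    hence "of_real l2 * k * (1 - cnj w2 * w2) = k" by (metis mult.commute mult.left_commute mult_1_right)
    hence "of_real l2 * k - 1 = w2 * (of_real l2 * k * cnj w2 - cnj w1)" by (simp add: k_def algebra_simps)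
    thus ?thesis using zD(1)[of l2] l12 by (simp add: z_def)
  qed
  define Y where "Y = (\<lambda>l. of_real \<alpha> * (h (z l) + Ln (1 - cnj w1 * z l)))"
  have zc: "continuous_on {l1..l2} z" unfolding z_def using zD(1) by (intro continuous_intros) auto
  have Ync: "1 - cnj w1 * z l \<notin> \<real>\<^sub>\<le>\<^sub>0" if "l \<in> {l1..l2}" for l
    using one_minus_cnj_mult_Re_pos[OF w(1) zD(2)[OF that]] by (auto simp: complex_nonpos_Reals_iff)
  have Yc: "continuous_on {l1..l2} Y" unfolding Y_def
    using zD(2) Ync
    by (intro continuous_intros zc continuous_on_compose2[OF holomorphic_on_imp_continuous_on[OF h]]) auto
  have "\<bar>Im (Y l2) - Im (Y l1)\<bar> < pi"
  proof (rule Im_log_segment_less_pi[OF l12 Yc, where \<sigma> = "\<lambda>l. l powr \<alpha>" and c = c1 and d = "c2 * exp (of_real \<alpha> * Ln k)"])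
    show "continuous_on {l1..l2} (\<lambda>l. l powr \<alpha>)" using zD(4) by (intro continuous_intros) force+
  next
    fix l assume l: "l \<in> {l1..l2}"
    note z = zD[OF l]
    define u where "u = Ln (1 - cnj w1 * z l)"
    define v where "v = Ln (1 - cnj w2 * z l)"
    have pos: "Re (1 - cnj w2 * z l) > 0" by (rule one_minus_cnj_mult_Re_pos[OF w(2) z(2)])
    (* Both factors lie in the right half-plane, so the principal logarithm is additive on their product. *)
    have Im1: "\<bar>Im (Ln k)\<bar> < pi/2" using kre Re_Ln_pos_lt[OF k0] by blast
    have nz: "1 - cnj w2 * z l \<noteq> 0" using pos by (metis less_irrefl zero_complex.sel(1))
    have Im2: "\<bar>Im v\<bar> < pi/2" unfolding v_def using pos Re_Ln_pos_lt[OF nz] by blast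
    have "u = Ln (of_real l * (k * (1 - cnj w2 * z l)))" unfolding u_def z(3) by (simp only: mult.assoc)
    also have "\<dots> = of_real (ln l) + Ln (k * (1 - cnj w2 * z l))"
      using z(4) k0 nz by (subst Ln_times_of_real) (auto simp: Ln_of_real)
    also have "Ln (k * (1 - cnj w2 * z l)) = Ln k + v"
      unfolding v_def using Im1 Im2[unfolded v_def] k0 nz by (intro Ln_times_simple) auto
    finally have uv: "u = of_real (ln l) + (Ln k + v)" .
    have "exp (Y l) = exp (of_real \<alpha> * h (z l)) * exp (of_real \<alpha> * u)"
      unfolding Y_def u_def by (simp add: distrib_left exp_add)
    also have "\<dots> = (c1 * exp (- of_real \<alpha> * u) + c2 * exp (- of_real \<alpha> * v)) * exp (of_real \<alpha> * u)"
      unfolding G[OF z(2)] disc_kernel_exp[OF w(1) z(2)] disc_kernel_exp[OF w(2) z(2)] u_def v_def ..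
    also have "\<dots> = c1 + c2 * exp (of_real \<alpha> * u - of_real \<alpha> * v)"
      by (simp add: distrib_right mult.assoc exp_diff exp_minus field_simps)
    also have "of_real \<alpha> * u - of_real \<alpha> * v = of_real \<alpha> * Ln k + of_real (\<alpha> * ln l)"
      unfolding uv by (simp add: algebra_simps)
    also have "exp \<dots> = exp (of_real \<alpha> * Ln k) * of_real (l powr \<alpha>)"
      using z(4) by (simp add: exp_add powr_def del: of_real_mult flip: exp_of_real)
    finally show "exp (Y l) = c1 + c2 * exp (of_real \<alpha> * Ln k) * of_real (l powr \<alpha>)"
      by (simp only: mult.assoc)
  qed
  also have "Im (Y l2) - Im (Y l1) = \<alpha> * (- (Im (h w1) - Im (h w2) - Im (Ln k)))"
  proof -
    have "1 - cnj w1 * w1 = of_real (1 - (norm w1)\<^sup>2)"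
      by (simp only: of_real_diff of_real_1 complex_norm_square mult.commute)
    hence "Im (Ln (1 - cnj w1 * w1)) = 0" using a1 Ln_of_real[OF a1] by simp
    thus ?thesis unfolding Y_def z1 z2 k_def by (simp add: algebra_simps)
  qed
  also have "\<bar>\<dots>\<bar> = \<alpha> * \<bar>Im (h w1) - Im (h w2) - Im (Ln k)\<bar>"
    using al by (simp only: abs_mult abs_minus abs_of_pos)
  finally show ?thesis unfolding k_def .
qed

section \<open>The norm of the interpolant in closed form\<close>

text \<open>
  The norm of exponent \<open>2 * \<beta>\<close> sees only the modulus, so it can be computed in the Hilbert space from any
  holomorphic \<open>k\<close> with \<open>\<bar>k\<bar> = \<bar>g\<bar>\<^sup>\<beta>\<close>. This covers powers of zero-free functions as well as multiples of
  kernels with a possibly vanishing factor.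
\<close>

lemma bergman_norm_via_power:
  assumes b: "\<beta> \<ge> 1" and k: "k holomorphic_on \<bbbD>" and a: "disc_series a k"
    and n: "\<And>z. z \<in> \<bbbD> \<Longrightarrow> norm (k z) = norm (g z) powr \<beta>"
  shows "bergman_norm \<beta> (2 * \<beta>) g = ennpow (coeff_energy \<beta> a) (1 / (2 * \<beta>))"
proof (cases "\<beta> = 1")
  case True
  have "hardy_norm g = hardy_norm k"
    unfolding hardy_norm_def
  proof (intro SUP_cong refl arg_cong2[where f = ennpow] nn_integral_cong)
    fix r \<theta> :: real assume "r \<in> {0<..<1}"
    hence "norm (k (of_real r * cis \<theta>)) = norm (g (of_real r * cis \<theta>))"
      using n[of "of_real r * cis \<theta>"] True by (simp add: norm_mult)
    thus "ennreal (norm (g (of_real r * cis \<theta>)) ^ 2 / (2 * pi)) * indicator {0..2 * pi} \<theta> =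
      ennreal (norm (k (of_real r * cis \<theta>)) ^ 2 / (2 * pi)) * indicator {0..2 * pi} \<theta>" by simp
  qed
  thus ?thesis using hardy_norm_eq[OF a] True by (simp add: bergman_norm_def)
next
  case False
  hence b': "\<beta> > 1" using b by simp
  have "(\<integral>\<^sup>+z\<in>\<bbbD>. ennreal (norm (g z) powr (2 * \<beta>) * (\<beta> - 1) * (1 - (norm z)\<^sup>2) powr (\<beta> - 2) / pi) \<partial>lborel)
     = (\<integral>\<^sup>+z\<in>\<bbbD>. ennreal ((norm (k z))\<^sup>2 * (\<beta> - 1) * (1 - (norm z)\<^sup>2) powr (\<beta> - 2) / pi) \<partial>lborel)"
  proof (intro nn_integral_cong)
    fix z
    have "norm (g z) powr (2 * \<beta>) = (norm (k z))\<^sup>2" if "z \<in> \<bbbD>"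
      unfolding n[OF that] by (simp add: power2_eq_square flip: powr_add)
    thus "ennreal (norm (g z) powr (2 * \<beta>) * (\<beta> - 1) * (1 - (norm z)\<^sup>2) powr (\<beta> - 2) / pi) * indicator \<bbbD> z
      = ennreal ((norm (k z))\<^sup>2 * (\<beta> - 1) * (1 - (norm z)\<^sup>2) powr (\<beta> - 2) / pi) * indicator \<bbbD> z"
      by (cases "z \<in> \<bbbD>") (simp_all only: indicator_simps mult_zero_right simp_thms)
  qed
  also have "\<dots> = coeff_energy \<beta> a" by (rule bergman_integral_eq[OF k a b'])
  finally show ?thesis using False by (simp add: bergman_norm_def)
qed

lemma disc_kernel_self:
  assumes "w \<in> \<bbbD>"
  shows "disc_kernel w \<beta> w = of_real (exp (- \<beta> * ln (1 - (norm w)\<^sup>2)))"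
proof -
  have a: "1 - (norm w)\<^sup>2 > 0" using assms by (auto simp: abs_square_less_1)
  have "1 - cnj w * w = of_real (1 - (norm w)\<^sup>2)"
    by (simp only: of_real_diff of_real_1 complex_norm_square mult.commute)
  hence "Ln (1 - cnj w * w) = of_real (ln (1 - (norm w)\<^sup>2))" using Ln_of_real[OF a] by simp
  thus ?thesis unfolding disc_kernel_exp[OF assms assms] by (simp only: of_real_mult of_real_minus exp_of_real[symmetric])
qed

lemma disc_kernel_commute:
  assumes "w \<in> \<bbbD>" "z \<in> \<bbbD>"
  shows "disc_kernel z \<beta> w = cnj (disc_kernel w \<beta> z)"
proof -
  have "1 - cnj w * z \<notin> \<real>\<^sub>\<le>\<^sub>0"
    using one_minus_cnj_mult_Re_pos[OF assms] by (auto simp: complex_nonpos_Reals_iff)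
  hence "cnj (Ln (1 - cnj w * z)) = Ln (cnj (1 - cnj w * z))" by (rule cnj_Ln)
  hence "Ln (1 - cnj z * w) = cnj (Ln (1 - cnj w * z))" by (simp add: mult.commute)
  thus ?thesis unfolding disc_kernel_exp[OF assms] disc_kernel_exp[OF assms(2,1)]
    by (simp add: exp_cnj)
qed

lemma disc_kernel_holomorphic:
  assumes "w \<in> \<bbbD>"
  shows "disc_kernel w \<beta> holomorphic_on \<bbbD>"
proof -
  have "(\<lambda>z. exp (- of_real \<beta> * Ln (1 - cnj w * z))) holomorphic_on \<bbbD>"
    using one_minus_cnj_mult_Re_pos[OF assms] 
    by (intro holomorphic_intros) (force simp: complex_nonpos_Reals_iff)
  thus ?thesis by (rule holomorphic_transform) (use disc_kernel_exp[OF assms] in auto)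
qed

lemma norm_disc_kernel:
  assumes "w \<in> \<bbbD>" "z \<in> \<bbbD>"
  shows "norm (disc_kernel w \<beta> z) = norm (1 - cnj w * z) powr (- \<beta>)"
proof -
  have nz: "1 - cnj w * z \<noteq> 0" using one_minus_cnj_mult_Re_pos[OF assms] by (metis less_irrefl zero_complex.sel(1))
  show ?thesis unfolding disc_kernel_exp[OF assms] using nz by (simp add: powr_def)
qed

text \<open>
  The value does not depend on \<open>\<beta>\<close>: this is the direction from single kernels to equality.
\<close>

lemma bergman_norm_kernel:
  assumes b: "\<beta> \<ge> 1" and w: "w \<in> \<bbbD>" and A: "A \<ge> 0"
    and g: "\<And>z. z \<in> \<bbbD> \<Longrightarrow> norm (g z) = A * norm (disc_kernel w 1 z)"
  shows "bergman_norm \<beta> (2 * \<beta>) g = ennreal (A * (1 - (norm w)\<^sup>2) powr (- 1 / 2))"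
proof -
  have a: "1 - (norm w)\<^sup>2 > 0" using w by (auto simp: abs_square_less_1)
  define d where "d = complex_of_real (A powr \<beta>)"
  define k where "k = (\<lambda>z. d * disc_kernel w \<beta> z + 0 * disc_kernel w \<beta> z)"
  have "bergman_norm \<beta> (2 * \<beta>) g = ennpow (coeff_energy \<beta> (two_kernel_coeff \<beta> d w 0 w)) (1 / (2 * \<beta>))"
  proof (rule bergman_norm_via_power[OF b, where k = k])
    show "k holomorphic_on \<bbbD>" unfolding k_def by (intro holomorphic_intros disc_kernel_holomorphic w)
    show "disc_series (two_kernel_coeff \<beta> d w 0 w) k" unfolding k_def by (rule disc_series_two_kernel[OF w w])
    fix z assume z: "z \<in> \<bbbD>"
    show "norm (k z) = norm (g z) powr \<beta>"
      using A by (simp add: k_def d_def g[OF z] norm_mult norm_disc_kernel[OF w z] powr_mult powr_powr powr_divide powr_minus_divide)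
  qed
  also have "coeff_energy \<beta> (two_kernel_coeff \<beta> d w 0 w) = ennreal (Re (cnj d * k w + cnj 0 * k w))"
    using b by (intro coeff_energy_two_kernel(1)[OF w w _ k_def]) simp
  also have "Re (cnj d * k w + cnj 0 * k w) = A powr (2 * \<beta>) * (1 - (norm w)\<^sup>2) powr (- \<beta>)"
    using a by (simp add: k_def d_def disc_kernel_self[OF w] powr_def[of "1 - (norm w)\<^sup>2"] mult_ac flip: powr_add)
  also have "ennpow (ennreal \<dots>) (1 / (2 * \<beta>)) = ennreal (A * (1 - (norm w)\<^sup>2) powr (- 1 / 2))"
    using b A by (subst ennpow_ennreal) (auto simp: powr_mult powr_powr)
  finally show ?thesis .
qed

text \<open>
  Solve the Gram system by Cramer's rule. Here \<open>L\<close> is the logarithm of \<open>1 - cnj w1 * w2\<close>, \<open>ai = 1 - \<bar>wi\<bar>\<^sup>2\<close>, and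
  \<open>hi\<close> is the logarithm of \<open>F\<close> at \<open>wi\<close>. All entries are exponentials, and the common factor
  \<open>exp (- 2 * \<beta> * m)\<close> cancels. In the degenerate case one of the numerators in Cramer's rule
  is a difference of two equal exponentials.
\<close>

lemma two_kernel_interpolation:
  fixes h1 h2 L :: complex and a1 a2 :: real
  assumes b: "\<beta> > 0" and a: "a1 > 0" "a2 > 0"
  defines "s \<equiv> Re L - (ln a1 + ln a2) / 2"
    and "p \<equiv> Re h1 + ln a1 / 2" and "q \<equiv> Re h2 + ln a2 / 2"
    and "\<psi> \<equiv> Im h1 - Im h2 - Im L"
  assumes s: "s > 0"
    and e1: "d1 * of_real (exp (- \<beta> * ln a1)) + d2 * cnj (exp (- of_real \<beta> * L)) = exp (of_real \<beta> * h1)"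
    and e2: "d1 * exp (- of_real \<beta> * L) + d2 * of_real (exp (- \<beta> * ln a2)) = exp (of_real \<beta> * h2)"
  shows "Re (cnj d1 * exp (of_real \<beta> * h1) + cnj d2 * exp (of_real \<beta> * h2))
       = exp (\<beta> * (p + q)) * two_point_norm s (p - q) \<psi> \<beta>"
    and "\<psi> = 0 \<Longrightarrow> \<bar>p - q\<bar> = s \<Longrightarrow> d1 = 0 \<or> d2 = 0"
proof -
  define A1 where "A1 = exp (- \<beta> * ln a1)"
  define A2 where "A2 = exp (- \<beta> * ln a2)"
  define \<kappa> where "\<kappa> = exp (- of_real \<beta> * L)"
  define v1 where "v1 = exp (of_real \<beta> * h1)"
  define v2 where "v2 = exp (of_real \<beta> * h2)"
  define \<Delta> where "\<Delta> = A1 * A2 - (norm \<kappa>)\<^sup>2"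
  define m where "m = (ln a1 + ln a2) / 2"
  have nk: "(norm \<kappa>)\<^sup>2 = exp (- 2 * \<beta> * m) * exp (- 2 * \<beta> * s)"
    by (simp add: \<kappa>_def s_def m_def power2_eq_square algebra_simps flip: exp_add)
  have AA: "A1 * A2 = exp (- 2 * \<beta> * m)"
    by (simp add: A1_def A2_def m_def algebra_simps flip: exp_add)
  have D: "\<Delta> = exp (- 2 * \<beta> * m) * (2 * (exp (- (\<beta> * s)) * sinh (\<beta> * s)))"
  proof -
    have "exp (- 2 * \<beta> * s) = exp (- (\<beta> * s)) * exp (- (\<beta> * s))" by (simp flip: exp_add)
    moreover have "1 = exp (- (\<beta> * s)) * exp (\<beta> * s)" by (simp flip: exp_add)
    ultimately have "1 - exp (- 2 * \<beta> * s) = 2 * (exp (- (\<beta> * s)) * sinh (\<beta> * s))"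
      by (simp add: sinh_field_def algebra_simps)
    from this[symmetric] show ?thesis unfolding \<Delta>_def AA nk by (simp only: right_diff_distrib mult_1_right)
  qed
  have D0: "\<Delta> > 0" unfolding D using b s by simp
  have kk: "\<kappa> * cnj \<kappa> = of_real ((norm \<kappa>)\<^sup>2)" by (simp only: complex_norm_square)
  have e1': "d1 * of_real A1 + d2 * cnj \<kappa> = v1" using e1 by (simp add: A1_def \<kappa>_def v1_def)
  have e2': "d1 * \<kappa> + d2 * of_real A2 = v2" using e2 by (simp add: A2_def \<kappa>_def v2_def)
  have d1: "d1 * of_real \<Delta> = v1 * of_real A2 - v2 * cnj \<kappa>"
    unfolding e1'[symmetric] e2'[symmetric] \<Delta>_def of_real_diff kk[symmetric] by (simp add: algebra_simps)
  have d2: "d2 * of_real \<Delta> = v2 * of_real A1 - v1 * \<kappa>"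
    unfolding e1'[symmetric] e2'[symmetric] \<Delta>_def of_real_diff kk[symmetric] by (simp add: algebra_simps)
  define X where "X = Re (cnj d1 * v1 + cnj d2 * v2)"
  have "X = Re (d1 * cnj v1 + d2 * cnj v2)" unfolding X_def by (simp add: algebra_simps)
  hence "X * \<Delta> = Re ((d1 * of_real \<Delta>) * cnj v1 + (d2 * of_real \<Delta>) * cnj v2)"
    by (simp add: algebra_simps)
  also have "\<dots> = Re (v1 * cnj v1) * A2 + Re (v2 * cnj v2) * A1 - Re (v2 * cnj \<kappa> * cnj v1) - Re (v1 * \<kappa> * cnj v2)"
    unfolding d1 d2 by (simp add: algebra_simps)
  also have "Re (v2 * cnj \<kappa> * cnj v1) = Re (v1 * \<kappa> * cnj v2)" by (simp add: algebra_simps)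
  also have "Re (v1 * cnj v1) * A2 = exp (- 2 * \<beta> * m) * exp (2 * \<beta> * p)"
  proof -
    have "v1 * cnj v1 = of_real ((norm v1)\<^sup>2)" by (simp only: complex_norm_square)
    hence "Re (v1 * cnj v1) = (norm v1)\<^sup>2" by (simp only: Re_complex_of_real)
    moreover have "(norm v1)\<^sup>2 * A2 = exp (\<beta> * Re h1 + \<beta> * Re h1 + - \<beta> * ln a2)"
      unfolding exp_add by (simp add: v1_def A2_def power2_eq_square)
    moreover have "\<beta> * Re h1 + \<beta> * Re h1 + - \<beta> * ln a2 = - 2 * \<beta> * m + 2 * \<beta> * p"
      by (simp add: p_def m_def field_simps)
    ultimately show ?thesis by (simp only: exp_add)
  qed
  also have "Re (v2 * cnj v2) * A1 = exp (- 2 * \<beta> * m) * exp (2 * \<beta> * q)"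
  proof -
    have "v2 * cnj v2 = of_real ((norm v2)\<^sup>2)" by (simp only: complex_norm_square)
    hence "Re (v2 * cnj v2) = (norm v2)\<^sup>2" by (simp only: Re_complex_of_real)
    moreover have "(norm v2)\<^sup>2 * A1 = exp (\<beta> * Re h2 + \<beta> * Re h2 + - \<beta> * ln a1)"
      unfolding exp_add by (simp add: v2_def A1_def power2_eq_square)
    moreover have "\<beta> * Re h2 + \<beta> * Re h2 + - \<beta> * ln a1 = - 2 * \<beta> * m + 2 * \<beta> * q"
      by (simp add: q_def m_def field_simps)
    ultimately show ?thesis by (simp only: exp_add)
  qed
  also have "Re (v1 * \<kappa> * cnj v2) = exp (- 2 * \<beta> * m) * (exp (\<beta> * (p + q)) * exp (- (\<beta> * s)) * cos (\<beta> * \<psi>))"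
  proof -
    have "v1 * \<kappa> * cnj v2 = exp (of_real \<beta> * (h1 - L + cnj h2))"
      by (simp add: v1_def v2_def \<kappa>_def exp_cnj algebra_simps flip: exp_add)
    hence "Re (v1 * \<kappa> * cnj v2) = exp (\<beta> * (Re h1 + Re h2 - Re L)) * cos (\<beta> * \<psi>)"
      by (simp add: Re_exp \<psi>_def algebra_simps)
    also have "\<beta> * (Re h1 + Re h2 - Re L) = - 2 * \<beta> * m + (\<beta> * (p + q) + - (\<beta> * s))"
      by (simp add: p_def q_def s_def m_def field_simps)
    finally show ?thesis by (simp only: exp_add mult.assoc)
  qed
  also have "exp (- 2 * \<beta> * m) * exp (2 * \<beta> * p) + exp (- 2 * \<beta> * m) * exp (2 * \<beta> * q)
      - exp (- 2 * \<beta> * m) * (exp (\<beta> * (p + q)) * exp (- (\<beta> * s)) * cos (\<beta> * \<psi>))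
      - exp (- 2 * \<beta> * m) * (exp (\<beta> * (p + q)) * exp (- (\<beta> * s)) * cos (\<beta> * \<psi>))
      = exp (- 2 * \<beta> * m) * (2 * (exp (\<beta> * (p + q)) * (cosh (\<beta> * (p - q)) - exp (- (\<beta> * s)) * cos (\<beta> * \<psi>))))"
  proof -
    have "exp (2 * \<beta> * p) = exp (\<beta> * (p + q)) * exp (\<beta> * (p - q))" 
         "exp (2 * \<beta> * q) = exp (\<beta> * (p + q)) * exp (- (\<beta> * (p - q)))"
      by (simp_all add: algebra_simps flip: exp_add)
    thus ?thesis by (simp add: cosh_field_def algebra_simps)
  qed
  finally have "X * \<Delta> = \<dots>" .
  hence "X = exp (\<beta> * (p + q)) * two_point_norm s (p - q) \<psi> \<beta>"
  proof -
    define S where "S = exp (- (\<beta> * s)) * sinh (\<beta> * s)"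
    define P where "P = exp (\<beta> * (p + q))"
    define C where "C = cosh (\<beta> * (p - q)) - exp (- (\<beta> * s)) * cos (\<beta> * \<psi>)"
    define M where "M = exp (- 2 * \<beta> * m)"
    have S: "S > 0" using b s by (simp add: S_def)
    have M: "M * 2 \<noteq> 0" by (simp add: M_def)
    assume "X * \<Delta> = exp (- 2 * \<beta> * m) * (2 * (exp (\<beta> * (p + q)) * (cosh (\<beta> * (p - q)) - exp (- (\<beta> * s)) * cos (\<beta> * \<psi>))))"
    hence "X * (M * (2 * S)) = M * (2 * (P * C))"
      unfolding D M_def[symmetric] S_def[symmetric] P_def[symmetric] C_def[symmetric] .
    hence "(M * 2) * (X * S) = (M * 2) * (P * C)" by (simp only: mult_ac)
    hence "X * S = P * C" using M by (simp only: mult_cancel_left simp_thms)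
    hence "X = P * (C / S)" using S by (simp add: field_simps)
    thus ?thesis unfolding two_point_norm_def P_def S_def C_def .
  qed
  thus "Re (cnj d1 * exp (of_real \<beta> * h1) + cnj d2 * exp (of_real \<beta> * h2))
       = exp (\<beta> * (p + q)) * two_point_norm s (p - q) \<psi> \<beta>"
    unfolding X_def v1_def v2_def .
  assume psi: "\<psi> = 0" and "\<bar>p - q\<bar> = s"
  hence "p - q = - s \<or> p - q = s" using s by (auto simp: abs_if split: if_splits)
  thus "d1 = 0 \<or> d2 = 0"
  proof
    assume t: "p - q = - s"
    have "h1 - of_real (ln a2) = h2 - cnj L"
      using t psi by (simp add: complex_eq_iff p_def q_def s_def \<psi>_def field_simps)
    hence "exp (of_real \<beta> * (h1 - of_real (ln a2))) = exp (of_real \<beta> * (h2 - cnj L))" by simp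
    hence "v1 * of_real A2 = v2 * cnj \<kappa>"
      by (simp add: v1_def v2_def A2_def \<kappa>_def exp_cnj algebra_simps flip: exp_add exp_of_real)
    hence "d1 * of_real \<Delta> = 0" unfolding d1 by simp
    thus ?thesis using D0 by simp
  next
    assume t: "p - q = s"
    have "h2 - of_real (ln a1) = h1 - L"
      using t psi by (simp add: complex_eq_iff p_def q_def s_def \<psi>_def field_simps)
    hence "exp (of_real \<beta> * (h2 - of_real (ln a1))) = exp (of_real \<beta> * (h1 - L))" by simp
    hence "v2 * of_real A1 = v1 * \<kappa>"
      by (simp add: v1_def v2_def A1_def \<kappa>_def algebra_simps flip: exp_add exp_of_real)
    hence "d2 * of_real \<Delta> = 0" unfolding d2 by simp
    thus ?thesis using D0 by simp
  qed
qed

section \<open>Comparison of the norms of the zero-free factor\<close>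

lemma two_by_two_solvable:
  fixes a b c d v1 v2 :: complex
  assumes "a * d \<noteq> b * c"
  shows "\<exists>x y. x * a + y * b = v1 \<and> x * c + y * d = v2"
proof -
  define D where "D = a * d - b * c"
  have D: "D \<noteq> 0" using assms by (simp add: D_def)
  have "(v1 * d - v2 * b) / D * a + (v2 * a - v1 * c) / D * b = v1 * D / D"
    unfolding times_divide_eq_left add_divide_distrib[symmetric] by (simp add: D_def algebra_simps)
  moreover have "(v1 * d - v2 * b) / D * c + (v2 * a - v1 * c) / D * d = v2 * D / D"
    unfolding times_divide_eq_left add_divide_distrib[symmetric] by (simp add: D_def algebra_simps)
  ultimately show ?thesis using D by (intro exI[of _ "(v1 * d - v2 * b) / D"] exI[of _ "(v2 * a - v1 * c) / D"]) simp
qed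

lemma log_power_holomorphic:
  assumes "h holomorphic_on \<bbbD>"
  shows "log_power h \<beta> holomorphic_on \<bbbD>"
  unfolding log_power_def using assms by (intro holomorphic_intros)

lemma norm_log_power:
  assumes "F z = exp (h z)"
  shows "norm (log_power h \<beta> z) = norm (F z) powr \<beta>"
  unfolding log_power_def assms norm_exp_eq_Re by (simp add: powr_def)

text \<open>
  At \<open>\<alpha>\<close> the function \<open>F\<^sup>\<alpha>\<close> is its own interpolant, and at smaller \<open>\<beta>\<close> the interpolant of \<open>F\<^sup>\<beta>\<close> gives a
  lower bound. The norms of the interpolants compare by \<open>ln_two_point_norm_decreasing\<close>.
\<close>

lemma two_kernel_alternative:
  assumes h: "h holomorphic_on \<bbbD>" and F: "\<And>z. z \<in> \<bbbD> \<Longrightarrow> F z = exp (h z)"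
    and al: "\<alpha> > 1" and w: "w1 \<in> \<bbbD>" "w2 \<in> \<bbbD>"
    and G: "\<And>z. z \<in> \<bbbD> \<Longrightarrow> log_power h \<alpha> z = c1 * disc_kernel w1 \<alpha> z + c2 * disc_kernel w2 \<alpha> z"
  shows "(\<exists>c w. w \<in> \<bbbD> \<and> (\<forall>z\<in>\<bbbD>. log_power h \<alpha> z = c * disc_kernel w \<alpha> z))
    \<or> (\<forall>\<beta>. 1 \<le> \<beta> \<and> \<beta> < \<alpha> \<longrightarrow> bergman_norm \<alpha> (2 * \<alpha>) F < bergman_norm \<beta> (2 * \<beta>) F)"
proof (cases "w1 = w2")
  case True
  have "\<forall>z\<in>\<bbbD>. log_power h \<alpha> z = (c1 + c2) * disc_kernel w1 \<alpha> z"
    using G True by (simp add: distrib_right)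
  with w(1) show ?thesis by blast
next
  case ne: False
  define k where "k = 1 - cnj w1 * w2"
  define L where "L = Ln k"
  define a1 where "a1 = 1 - (norm w1)\<^sup>2"
  define a2 where "a2 = 1 - (norm w2)\<^sup>2"
  define s where "s = Re L - (ln a1 + ln a2) / 2"
  define p where "p = Re (h w1) + ln a1 / 2"
  define q where "q = Re (h w2) + ln a2 / 2"
  define \<psi> where "\<psi> = Im (h w1) - Im (h w2) - Im L"
  define N where "N = (\<lambda>x. exp (x * (p + q)) * two_point_norm s (p - q) \<psi> x)"
  have a: "a1 > 0" "a2 > 0" using w by (auto simp: a1_def a2_def abs_square_less_1)
  have k0: "k \<noteq> 0" using one_minus_cnj_mult_Re_pos[OF w] unfolding k_def by (metis less_irrefl zero_complex.sel(1))
  have s: "s > 0"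
  proof -
    have "a1 * a2 < (norm k)\<^sup>2"
      unfolding a1_def a2_def k_def norm_one_minus_cnj_mult using ne by simp
    hence "ln (a1 * a2) < ln ((norm k)\<^sup>2)" using a k0 by (subst ln_less_cancel_iff) auto
    hence "ln a1 + ln a2 < 2 * ln (norm k)" using a k0 by (simp add: ln_mult ln_realpow)
    thus ?thesis using k0 by (simp add: s_def L_def)
  qed
  have K: "disc_kernel w1 \<beta> w1 = of_real (exp (- \<beta> * ln a1))" "disc_kernel w2 \<beta> w2 = of_real (exp (- \<beta> * ln a2))"
    "disc_kernel w1 \<beta> w2 = exp (- of_real \<beta> * L)" "disc_kernel w2 \<beta> w1 = cnj (exp (- of_real \<beta> * L))" for \<beta>
    unfolding a1_def a2_def L_def k_def disc_kernel_commute[OF w] disc_kernel_exp[OF w]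
    using disc_kernel_self w by auto
  have val: "Re (cnj d1 * log_power h \<beta> w1 + cnj d2 * log_power h \<beta> w2) = N \<beta>"
    and deg: "\<psi> = 0 \<Longrightarrow> \<bar>p - q\<bar> = s \<Longrightarrow> d1 = 0 \<or> d2 = 0"
    if "\<beta> > 0" "d1 * disc_kernel w1 \<beta> w1 + d2 * disc_kernel w2 \<beta> w1 = log_power h \<beta> w1"
      "d1 * disc_kernel w1 \<beta> w2 + d2 * disc_kernel w2 \<beta> w2 = log_power h \<beta> w2" for \<beta> d1 d2
    using two_kernel_interpolation[OF that(1) a s[unfolded s_def], of d1 d2 "h w1" "h w2"] that(2,3)
    unfolding K log_power_def N_def p_def q_def \<psi>_def s_def by blast+
  have N0: "N x > 0" if "x > 0" for x unfolding N_def using two_point_norm_pos[OF s that] by simp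
  show ?thesis
  proof (cases "\<psi> = 0 \<and> \<bar>p - q\<bar> = s")
    case True
    have "c1 = 0 \<or> c2 = 0"
      using deg[of \<alpha> c1 c2] True al G[OF w(1)] G[OF w(2)] by simp
    thus ?thesis
    proof
      assume "c1 = 0"
      thus ?thesis using G w by (intro disjI1 exI[of _ c2] exI[of _ w2]) simp
    next
      assume "c2 = 0"
      thus ?thesis using G w by (intro disjI1 exI[of _ c1] exI[of _ w1]) simp
    qed
  next
    case False
    have norm_eq: "bergman_norm \<alpha> (2 * \<alpha>) F = ennreal (N \<alpha> powr (1 / (2 * \<alpha>)))"
    proof -
      have "bergman_norm \<alpha> (2 * \<alpha>) F = ennpow (coeff_energy \<alpha> (two_kernel_coeff \<alpha> c1 w1 c2 w2)) (1 / (2 * \<alpha>))"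
      proof (rule bergman_norm_via_power[where k = "log_power h \<alpha>"])
        show "disc_series (two_kernel_coeff \<alpha> c1 w1 c2 w2) (log_power h \<alpha>)"
          using disc_series_two_kernel[OF w, of \<alpha> c1 c2] G by (simp add: disc_series_def)
      qed (use al log_power_holomorphic[OF h] norm_log_power[of F _ h, OF F] in auto)
      also have "coeff_energy \<alpha> (two_kernel_coeff \<alpha> c1 w1 c2 w2) = ennreal (N \<alpha>)"
        using coeff_energy_two_kernel(1)[OF w _ refl, of \<alpha> c1 c2] val[of \<alpha> c1 c2] al G[OF w(1)] G[OF w(2)] by simp
      also have "ennpow \<dots> (1 / (2 * \<alpha>)) = ennreal (N \<alpha> powr (1 / (2 * \<alpha>)))"
        using N0[of \<alpha>] al by (intro ennpow_ennreal) simp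
      finally show ?thesis .
    qed
    have norm_ge: "ennreal (N \<beta> powr (1 / (2 * \<beta>))) \<le> bergman_norm \<beta> (2 * \<beta>) F" if b: "\<beta> \<ge> 1" for \<beta>
    proof -
      define A where "A = (\<lambda>n. (deriv ^^ n) (log_power h \<beta>) 0 / fact n)"
      have A: "disc_series A (log_power h \<beta>)"
        unfolding A_def by (intro holomorphic_disc_series log_power_holomorphic h)
      have "disc_kernel w1 \<beta> w1 * disc_kernel w2 \<beta> w2 \<noteq> disc_kernel w2 \<beta> w1 * disc_kernel w1 \<beta> w2"
      proof
        assume "disc_kernel w1 \<beta> w1 * disc_kernel w2 \<beta> w2 = disc_kernel w2 \<beta> w1 * disc_kernel w1 \<beta> w2"
        hence "norm (disc_kernel w1 \<beta> w1 * disc_kernel w2 \<beta> w2) = norm (disc_kernel w2 \<beta> w1 * disc_kernel w1 \<beta> w2)" by simp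
        hence "exp (- \<beta> * (ln a1 + ln a2)) = exp (- \<beta> * (2 * Re L))"
          unfolding K norm_mult by (simp add: algebra_simps flip: exp_add)
        thus False using s b by (simp add: s_def)
      qed
      from two_by_two_solvable[OF this, of "log_power h \<beta> w1" "log_power h \<beta> w2"]
      obtain d1 d2 where d: "d1 * disc_kernel w1 \<beta> w1 + d2 * disc_kernel w2 \<beta> w1 = log_power h \<beta> w1"
        "d1 * disc_kernel w1 \<beta> w2 + d2 * disc_kernel w2 \<beta> w2 = log_power h \<beta> w2" by blast
      have "ennreal (N \<beta>) \<le> coeff_energy \<beta> A"
        using coeff_energy_ge_interpolant[OF A w _ refl d] val[OF _ d] b by simp
      hence "ennpow (ennreal (N \<beta>)) (1 / (2 * \<beta>)) \<le> ennpow (coeff_energy \<beta> A) (1 / (2 * \<beta>))"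
        using b by (intro ennpow_mono) auto
      also have "ennpow (ennreal (N \<beta>)) (1 / (2 * \<beta>)) = ennreal (N \<beta> powr (1 / (2 * \<beta>)))"
        using N0[of \<beta>] b by (intro ennpow_ennreal) simp
      also have "ennpow (coeff_energy \<beta> A) (1 / (2 * \<beta>)) = bergman_norm \<beta> (2 * \<beta>) F"
        using bergman_norm_via_power[OF b log_power_holomorphic[OF h] A norm_log_power[of F _ h, OF F]] by simp
      finally show ?thesis .
    qed
    have psi: "\<alpha> * \<bar>\<psi>\<bar> \<le> pi"
      using phase_bound[OF h w ne, of \<alpha> c1 c2] al G unfolding \<psi>_def L_def k_def log_power_def by simp
    have Npow: "N x powr (1 / (2 * x)) = exp ((p + q) / 2 + ln (two_point_norm s (p - q) \<psi> x) / x / 2)" if "x > 0" for x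
    proof -
      have "ln (N x) = x * (p + q) + ln (two_point_norm s (p - q) \<psi> x)"
        unfolding N_def using two_point_norm_pos[OF s that, of "p - q" \<psi>] by (simp add: ln_mult)
      thus ?thesis using N0[OF that] that by (simp add: powr_def field_simps)
    qed
    have "bergman_norm \<alpha> (2 * \<alpha>) F < bergman_norm \<beta> (2 * \<beta>) F" if b: "1 \<le> \<beta>" "\<beta> < \<alpha>" for \<beta>
    proof -
      have "ln (two_point_norm s (p - q) \<psi> \<alpha>) / \<alpha> < ln (two_point_norm s (p - q) \<psi> \<beta>) / \<beta>"
        by (rule ln_two_point_norm_decreasing[OF s _ _ psi]) (use b False in auto)
      hence "N \<alpha> powr (1 / (2 * \<alpha>)) < N \<beta> powr (1 / (2 * \<beta>))"
        using Npow[of \<alpha>] Npow[of \<beta>] b by simp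
      hence "ennreal (N \<alpha> powr (1 / (2 * \<alpha>))) < ennreal (N \<beta> powr (1 / (2 * \<beta>)))"
        by (intro ennreal_lessI) (auto intro: le_less_trans[OF powr_ge_zero])
      thus ?thesis using norm_ge[OF b(1)] unfolding norm_eq by (rule less_le_trans)
    qed
    thus ?thesis by blast
  qed
qed

text \<open>
  Taking roots of the modulus turns a single kernel of exponent \<open>\<alpha>\<close> into one of exponent \<open>1\<close>.
\<close>

lemma norm_of_log_power_kernel:
  assumes al: "\<alpha> > 0" and F: "F z = exp (h z)" and w: "w \<in> \<bbbD>" "z \<in> \<bbbD>"
    and G: "log_power h \<alpha> z = c * disc_kernel w \<alpha> z"
  shows "norm (F z) = norm c powr (1 / \<alpha>) * norm (disc_kernel w 1 z)"
proof -
  have "norm (F z) = norm (log_power h \<alpha> z) powr (1 / \<alpha>)"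
    unfolding norm_log_power[of F _ h, OF F] using al by (simp add: powr_powr)
  also have "\<dots> = norm c powr (1 / \<alpha>) * norm (disc_kernel w 1 z)"
    unfolding G norm_mult norm_disc_kernel[OF w] using al by (simp add: powr_mult powr_powr)
  finally show ?thesis .
qed

lemma disc_kernel_norm_le:
  assumes "w \<in> \<bbbD>" "z \<in> \<bbbD>" "\<beta> > 0"
  shows "norm (disc_kernel w \<beta> z) \<le> (1 - norm w) powr (- \<beta>)"
proof -
  have "norm (cnj w * z) \<le> norm w * 1" unfolding norm_mult using assms by (intro mult_mono) auto
  hence "1 - norm w \<le> norm (1 - cnj w * z)" using norm_triangle_ineq2[of 1 "cnj w * z"] by simp
  thus ?thesis unfolding norm_disc_kernel[OF assms(1,2)] using assms by (intro powr_mono2') auto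
qed

section \<open>The inner factor\<close>

lemma circle_point_in_disc: "r \<in> {0<..<1} \<Longrightarrow> of_real r * cis \<theta> \<in> \<bbbD>"
  by (simp add: norm_mult)

lemma measurable_on_circle:
  assumes "g holomorphic_on \<bbbD>" and r: "r \<in> {0<..<1::real}"
  shows "(\<lambda>\<theta>. g (of_real r * cis \<theta>)) \<in> borel_measurable borel"
proof (rule borel_measurable_continuous_onI)
  have "(\<lambda>\<theta>. of_real r * cis \<theta>) ` UNIV \<subseteq> \<bbbD>" using circle_point_in_disc[OF r] by blast
  thus "continuous_on UNIV (\<lambda>\<theta>. g (of_real r * cis \<theta>))"
    by (intro continuous_on_compose2[OF holomorphic_on_imp_continuous_on[OF assms(1)]] continuous_intros)
qed

text \<open>
  The integrand lies between \<open>0\<close> and \<open>1\<close> and tends to \<open>0\<close> at almost every angle.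
\<close>

lemma inner_function_defect_tendsto_0:
  assumes eta: "inner_function \<eta>" and r: "\<And>n. r n \<in> {0<..<1}" and lim: "r \<longlonglongrightarrow> 1"
  shows "(\<lambda>n. \<integral>\<^sup>+\<theta>\<in>{0..2*pi}. ennreal (1 - (norm (\<eta> (of_real (r n) * cis \<theta>)))\<^sup>2) \<partial>lborel) \<longlonglongrightarrow> 0"
proof -
  have hol: "\<eta> holomorphic_on \<bbbD>" and le: "\<And>z. z \<in> \<bbbD> \<Longrightarrow> norm (\<eta> z) \<le> 1"
    and rad: "AE \<theta> in lborel. \<theta> \<in> {0..2*pi} \<longrightarrow>
       (\<exists>l. ((\<lambda>r. \<eta> (of_real r * cis \<theta>)) \<longlongrightarrow> l) (at_left (1::real)) \<and> norm l = 1)"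
    using eta unfolding inner_function_def by auto
  have [measurable]: "(\<lambda>\<theta>. \<eta> (of_real (r n) * cis \<theta>)) \<in> borel_measurable borel" for n
    by (rule measurable_on_circle[OF hol r])
  have rlim: "filterlim r (at_left 1) sequentially"
  proof -
    have "\<forall>\<^sub>F n in sequentially. r n \<in> {..<1} \<and> r n \<noteq> 1"
      using r by (intro always_eventually allI conjI) (auto dest: spec simp: less_imp_neq)
    thus ?thesis using lim by (simp add: filterlim_at)
  qed
  have "(\<lambda>n. \<integral>\<^sup>+\<theta>\<in>{0..2*pi}. ennreal (1 - (norm (\<eta> (of_real (r n) * cis \<theta>)))\<^sup>2) \<partial>lborel) \<longlonglongrightarrow> (\<integral>\<^sup>+\<theta>. 0 \<partial>(lborel::real measure))"
  proof (rule nn_integral_dominated_convergence[where w = "indicator {0..2*pi}"])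
    show "AE \<theta> in lborel. ennreal (1 - (norm (\<eta> (of_real (r n) * cis \<theta>)))\<^sup>2) * indicator {0..2*pi} \<theta> \<le> indicator {0..2*pi} \<theta>" for n
      by (intro AE_I2) (auto simp: indicator_def)
    show "(\<integral>\<^sup>+\<theta>. indicator {0..2*pi} \<theta> \<partial>(lborel::real measure)) < \<infinity>" by simp
    show "AE \<theta> in lborel. (\<lambda>n. ennreal (1 - (norm (\<eta> (of_real (r n) * cis \<theta>)))\<^sup>2) * indicator {0..2*pi} \<theta>) \<longlonglongrightarrow> 0"
      using rad
    proof eventually_elim
      case (elim \<theta>)
      show ?case
      proof (cases "\<theta> \<in> {0..2*pi}")
        case True
        then obtain l where l: "((\<lambda>r. \<eta> (of_real r * cis \<theta>)) \<longlongrightarrow> l) (at_left (1::real))" "norm l = 1"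
          using elim by blast
        have "(\<lambda>n. \<eta> (of_real (r n) * cis \<theta>)) \<longlonglongrightarrow> l" by (rule filterlim_compose[OF l(1) rlim])
        hence "(\<lambda>n. ennreal (1 - (norm (\<eta> (of_real (r n) * cis \<theta>)))\<^sup>2)) \<longlonglongrightarrow> ennreal (1 - (norm l)\<^sup>2)"
          by (intro tendsto_intros tendsto_ennrealI)
        thus ?thesis using True l(2) by simp
      qed simp
    qed
  qed auto
  thus ?thesis by simp
qed

text \<open>
  On each circle the mean of \<open>\<bar>F\<bar>\<^sup>2 - \<bar>f\<bar>\<^sup>2 = \<bar>F\<bar>\<^sup>2 * (1 - \<bar>\<eta>\<bar>\<^sup>2)\<close> is at most a constant times the mean of
  \<open>1 - \<bar>\<eta>\<bar>\<^sup>2\<close>, which tends to \<open>0\<close> at the boundary. Since the means of \<open>\<bar>F\<bar>\<^sup>2\<close> increase with the radius,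
  a fixed radius can be compared with radii tending to \<open>1\<close>.
\<close>

lemma hardy_norm_inner_multiple:
  assumes eta: "inner_function \<eta>" and F: "F holomorphic_on \<bbbD>" and B: "\<And>z. z \<in> \<bbbD> \<Longrightarrow> norm (F z) \<le> B"
    and f: "\<And>z. z \<in> \<bbbD> \<Longrightarrow> f z = \<eta> z * F z"
  shows "hardy_norm F \<le> hardy_norm f"
proof -
  define M where "M = (\<lambda>g r. \<integral>\<^sup>+\<theta>\<in>{0..2*pi}. ennreal (norm (g (of_real r * cis \<theta>) :: complex) ^ 2 / (2 * pi)) \<partial>lborel)"
  have hn: "hardy_norm g = ennpow (SUP r\<in>{0<..<1}. M g r) (1/2)" for g
    unfolding hardy_norm_def M_def by (rule SUP_ennpow) simp
  have hol: "\<eta> holomorphic_on \<bbbD>" and le: "\<And>z. z \<in> \<bbbD> \<Longrightarrow> norm (\<eta> z) \<le> 1"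
    using eta unfolding inner_function_def by auto
  have B0: "B \<ge> 0" using order_trans[OF norm_ge_zero B[of 0]] by simp
  define a where "a = (\<lambda>n. (deriv ^^ n) F 0 / fact n)"
  have a: "disc_series a F" unfolding a_def by (rule holomorphic_disc_series[OF F])
  have MF: "M F r = (\<Sum>n. ennreal ((norm (a n))\<^sup>2 * (r\<^sup>2) ^ n))" if "r \<in> {0<..<1}" for r
  proof -
    have "norm (complex_of_real r) < 1" using that by simp
    from disc_series_circle_mean[OF a this] show ?thesis unfolding norm_of_real power2_abs M_def .
  qed
  have mono: "M F r \<le> M F r'" if "r \<in> {0<..<1}" "r' \<in> {0<..<1}" "r \<le> r'" for r r'
    unfolding MF[OF that(1)] MF[OF that(2)] using that
    by (intro suminf_le ennreal_leI mult_left_mono power_mono) auto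
  define e where "e = (\<lambda>r. \<integral>\<^sup>+\<theta>\<in>{0..2*pi}. ennreal (1 - (norm (\<eta> (of_real r * cis \<theta>)))\<^sup>2) \<partial>lborel)"
  have split: "M F r \<le> M f r + ennreal (B\<^sup>2 / (2 * pi)) * e r" if r: "r \<in> {0<..<1}" for r
  proof -
    have [measurable]: "(\<lambda>\<theta>. \<eta> (of_real r * cis \<theta>)) \<in> borel_measurable borel"
      by (rule measurable_on_circle[OF hol r])
    have [measurable]: "(\<lambda>\<theta>. F (of_real r * cis \<theta>)) \<in> borel_measurable borel"
      by (rule measurable_on_circle[OF F r])
    have feq: "f (of_real r * cis \<theta>) = \<eta> (of_real r * cis \<theta>) * F (of_real r * cis \<theta>)" for \<theta>
      by (rule f[OF circle_point_in_disc[OF r]])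
    have "M F r \<le> (\<integral>\<^sup>+\<theta>. ennreal (norm (f (of_real r * cis \<theta>)) ^ 2 / (2 * pi)) * indicator {0..2*pi} \<theta>
        + ennreal (B\<^sup>2 / (2 * pi)) * (ennreal (1 - (norm (\<eta> (of_real r * cis \<theta>)))\<^sup>2) * indicator {0..2*pi} \<theta>) \<partial>lborel)"
      unfolding M_def
    proof (intro nn_integral_mono)
      fix \<theta>
      define x where "x = norm (\<eta> (of_real r * cis \<theta>))"
      define y where "y = norm (F (of_real r * cis \<theta>))"
      have x: "0 \<le> x" "x \<le> 1" unfolding x_def using le[OF circle_point_in_disc[OF r]] by auto
      have y: "0 \<le> y" "y \<le> B" unfolding y_def using B[OF circle_point_in_disc[OF r]] by auto
      have x2: "x\<^sup>2 \<le> 1" using x by (simp add: power_le_one)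
      have "y\<^sup>2 * (1 - x\<^sup>2) \<le> B\<^sup>2 * (1 - x\<^sup>2)" using x2 y by (intro mult_right_mono power_mono) auto
      hence "y\<^sup>2 \<le> (x * y)\<^sup>2 + B\<^sup>2 * (1 - x\<^sup>2)" by (simp add: power_mult_distrib algebra_simps)
      hence "y\<^sup>2 / (2 * pi) \<le> ((x * y)\<^sup>2 + B\<^sup>2 * (1 - x\<^sup>2)) / (2 * pi)" by (rule divide_right_mono) simp
      also have "\<dots> = (x * y)\<^sup>2 / (2 * pi) + B\<^sup>2 / (2 * pi) * (1 - x\<^sup>2)" by (simp add: add_divide_distrib)
      finally have "ennreal (y\<^sup>2 / (2 * pi)) \<le> ennreal ((x * y)\<^sup>2 / (2 * pi) + B\<^sup>2 / (2 * pi) * (1 - x\<^sup>2))"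
        by (rule ennreal_leI)
      also have "\<dots> = ennreal ((x * y)\<^sup>2 / (2 * pi)) + ennreal (B\<^sup>2 / (2 * pi)) * ennreal (1 - x\<^sup>2)"
        using x2 by (simp add: ennreal_plus ennreal_mult'[symmetric] del: ennreal_plus)
          (simp add: ennreal_plus flip: ennreal_mult)
      finally show "ennreal ((norm (F (of_real r * cis \<theta>)))\<^sup>2 / (2 * pi)) * indicator {0..2*pi} \<theta>
        \<le> ennreal (norm (f (of_real r * cis \<theta>)) ^ 2 / (2 * pi)) * indicator {0..2*pi} \<theta>
        + ennreal (B\<^sup>2 / (2 * pi)) * (ennreal (1 - (norm (\<eta> (of_real r * cis \<theta>)))\<^sup>2) * indicator {0..2*pi} \<theta>)"
        unfolding feq norm_mult x_def[symmetric] y_def[symmetric] by (simp add: indicator_def)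
    qed
    also have "\<dots> = M f r + ennreal (B\<^sup>2 / (2 * pi)) * e r"
      unfolding M_def e_def feq by (subst nn_integral_add) (auto simp: nn_integral_cmult)
    finally show ?thesis .
  qed
  define S where "S = (SUP r\<in>{0<..<1}. M f r)"
  have "M F r \<le> S" if r: "r \<in> {0<..<1}" for r
  proof -
    (* Radii between r and 1 that tend to 1. *)
  define \<rho> where "\<rho> = (\<lambda>n. 1 - (1 - r) * (1 / real (Suc n)))"
    have \<rho>: "\<rho> n \<in> {0<..<1}" "r \<le> \<rho> n" for n
    proof -
      have "(1 - r) * (1 / real (Suc n)) \<le> (1 - r) * 1" using r by (intro mult_left_mono) auto
      moreover have "(1 - r) * (1 / real (Suc n)) > 0" using r by (intro mult_pos_pos) auto
      ultimately show "\<rho> n \<in> {0<..<1}" "r \<le> \<rho> n" using r by (auto simp: \<rho>_def)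
    qed
    have "\<rho> \<longlonglongrightarrow> 1 - (1 - r) * 0" unfolding \<rho>_def
      by (intro tendsto_intros LIMSEQ_Suc[OF lim_1_over_n])
    hence "(\<lambda>n. e (\<rho> n)) \<longlonglongrightarrow> 0" unfolding e_def
      by (intro inner_function_defect_tendsto_0[OF eta \<rho>(1)]) simp
    hence "(\<lambda>n. S + ennreal (B\<^sup>2 / (2 * pi)) * e (\<rho> n)) \<longlonglongrightarrow> S + ennreal (B\<^sup>2 / (2 * pi)) * 0"
      by (intro tendsto_add tendsto_const ennreal_tendsto_cmult) auto
    moreover have "M F r \<le> S + ennreal (B\<^sup>2 / (2 * pi)) * e (\<rho> n)" for n
    proof -
      have "M F r \<le> M F (\<rho> n)" using mono[OF r \<rho>] .
      also have "\<dots> \<le> M f (\<rho> n) + ennreal (B\<^sup>2 / (2 * pi)) * e (\<rho> n)" by (rule split[OF \<rho>(1)])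
      also have "\<dots> \<le> S + ennreal (B\<^sup>2 / (2 * pi)) * e (\<rho> n)"
        unfolding S_def by (intro add_right_mono SUP_upper \<rho>(1))
      finally show ?thesis .
    qed
    ultimately show ?thesis by (intro LIMSEQ_le_const[of _ S]) auto
  qed
  hence "(SUP r\<in>{0<..<1}. M F r) \<le> S" by (rule SUP_least)
  thus ?thesis unfolding hn S_def by (rule ennpow_mono) simp
qed

lemma bergman_norm_mono:
  assumes "\<alpha> > 1" and "\<And>z. z \<in> \<bbbD> \<Longrightarrow> norm (f z) \<le> norm (g z)"
  shows "bergman_norm \<alpha> (2 * \<alpha>) f \<le> bergman_norm \<alpha> (2 * \<alpha>) g"
proof -
  have "(\<integral>\<^sup>+z\<in>\<bbbD>. ennreal (norm (f z) powr (2 * \<alpha>) * (\<alpha> - 1) * (1 - (norm z)\<^sup>2) powr (\<alpha> - 2) / pi) \<partial>lborel)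
    \<le> (\<integral>\<^sup>+z\<in>\<bbbD>. ennreal (norm (g z) powr (2 * \<alpha>) * (\<alpha> - 1) * (1 - (norm z)\<^sup>2) powr (\<alpha> - 2) / pi) \<partial>lborel)"
  proof (rule nn_integral_mono)
    fix z
    show "ennreal (norm (f z) powr (2 * \<alpha>) * (\<alpha> - 1) * (1 - (norm z)\<^sup>2) powr (\<alpha> - 2) / pi) * indicator \<bbbD> z
      \<le> ennreal (norm (g z) powr (2 * \<alpha>) * (\<alpha> - 1) * (1 - (norm z)\<^sup>2) powr (\<alpha> - 2) / pi) * indicator \<bbbD> z"
    proof (cases "z \<in> \<bbbD>")
      case True
      have "norm (f z) powr (2 * \<alpha>) \<le> norm (g z) powr (2 * \<alpha>)"
        using assms(1) assms(2)[OF True] by (intro powr_mono2) auto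
      thus ?thesis using assms(1)
        by (intro mult_right_mono ennreal_leI divide_right_mono) auto
    qed simp
  qed
  thus ?thesis unfolding bergman_norm_def using assms(1) by (simp add: ennpow_mono)
qed

text \<open>
  The integrands differ at every point of the disc, a set of positive measure, and the larger
  integral is finite.
\<close>

lemma bergman_norm_strict_mono:
  assumes al: "\<alpha> > 1" and fg: "f holomorphic_on \<bbbD>" "g holomorphic_on \<bbbD>"
    and lt: "\<And>z. z \<in> \<bbbD> \<Longrightarrow> norm (f z) < norm (g z)" and fin: "bergman_norm \<alpha> (2 * \<alpha>) g < \<infinity>"
  shows "bergman_norm \<alpha> (2 * \<alpha>) f < bergman_norm \<alpha> (2 * \<alpha>) g"
proof -
  define I where "I = (\<lambda>u z. ennreal (norm (u z :: complex) powr (2 * \<alpha>) * (\<alpha> - 1) * (1 - (norm z)\<^sup>2) powr (\<alpha> - 2) / pi) * indicator \<bbbD> z)"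
  have bn: "bergman_norm \<alpha> (2 * \<alpha>) u = ennpow (\<integral>\<^sup>+z. I u z \<partial>lborel) (1 / (2 * \<alpha>))" for u
    using al by (simp add: bergman_norm_def I_def)
  have meas: "I u \<in> borel_measurable lborel" if "u holomorphic_on \<bbbD>" for u
  proof -
    have [measurable]: "(\<lambda>z. indicator \<bbbD> z *\<^sub>R u z) \<in> borel_measurable borel"
      by (intro borel_measurable_continuous_on_indicator holomorphic_on_imp_continuous_on that) auto
    have "(\<lambda>z. ennreal (norm (indicator \<bbbD> z *\<^sub>R u z) powr (2 * \<alpha>) * (\<alpha> - 1) * (1 - (norm z)\<^sup>2) powr (\<alpha> - 2) / pi)) \<in> borel_measurable lborel"
      by measurable
    also have "(\<lambda>z. ennreal (norm (indicator \<bbbD> z *\<^sub>R u z) powr (2 * \<alpha>) * (\<alpha> - 1) * (1 - (norm z)\<^sup>2) powr (\<alpha> - 2) / pi)) = I u"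
      using al by (auto simp: I_def indicator_def fun_eq_iff)
    finally show ?thesis .
  qed
  have ltI: "I f z < I g z" if "z \<in> \<bbbD>" for z
  proof -
    have "norm (f z) powr (2 * \<alpha>) < norm (g z) powr (2 * \<alpha>)"
      using lt[OF that] al by (intro powr_less_mono2) auto
    moreover have "(1 - (norm z)\<^sup>2) powr (\<alpha> - 2) > 0" using that by (auto simp: abs_square_eq_1 power2_eq_1_iff)
    ultimately have "norm (f z) powr (2 * \<alpha>) * (\<alpha> - 1) * (1 - (norm z)\<^sup>2) powr (\<alpha> - 2) / pi
       < norm (g z) powr (2 * \<alpha>) * (\<alpha> - 1) * (1 - (norm z)\<^sup>2) powr (\<alpha> - 2) / pi"
      using al by (intro divide_strict_right_mono mult_strict_right_mono) auto
    moreover have "0 \<le> norm (f z) powr (2 * \<alpha>) * (\<alpha> - 1) * (1 - (norm z)\<^sup>2) powr (\<alpha> - 2) / pi"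
      using al by simp
    ultimately show ?thesis using that unfolding I_def by (simp add: ennreal_lessI le_less_trans)
  qed
  have leI: "I f z \<le> I g z" for z
    using ltI[of z] by (cases "z \<in> \<bbbD>") (auto simp: I_def)
  have finf: "(\<integral>\<^sup>+z. I g z \<partial>lborel) \<noteq> \<infinity>" using fin unfolding bn by (auto simp: ennpow_def)
  have "(\<integral>\<^sup>+z. I f z \<partial>lborel) < (\<integral>\<^sup>+z. I g z \<partial>lborel)"
  proof (rule nn_integral_less)
    show "(\<integral>\<^sup>+z. I f z \<partial>lborel) \<noteq> \<infinity>"
      using nn_integral_mono[of lborel "I f" "I g", OF leI] finf by (auto simp: top_unique)
    show "\<not> (AE z in lborel. I g z \<le> I f z)"
    proof
      assume "AE z in lborel. I g z \<le> I f z"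
      hence "AE z in lborel. z \<notin> \<bbbD>" by eventually_elim (use ltI in \<open>auto simp: not_le[symmetric]\<close>)
      hence "emeasure lborel \<bbbD> = 0" by (subst (asm) AE_iff_measurable[of \<bbbD>]) auto
      thus False by (subst (asm) emeasure_ball) (auto simp: unit_ball_vol_2)
    qed
  qed (use meas fg leI in auto)
  thus ?thesis unfolding bn using ennpow_le_iff[of "1 / (2 * \<alpha>)"] al by (simp add: not_le[symmetric])
qed

theorem theorem1p1:
  fixes f \<eta> F h :: "complex \<Rightarrow> complex"
    and \<alpha> :: real and c1 c2 w1 w2 :: complex
  assumes "f \<in> hardy_space"
    and "inner_function \<eta>"
    and "F holomorphic_on \<bbbD>"
    and "\<forall>z\<in>\<bbbD>. F z \<noteq> 0"
    and "\<forall>z\<in>\<bbbD>. f z = \<eta> z * F z"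
    and "holomorphic_log_of h F"
    and "\<alpha> > 1"
    and "w1 \<in> \<bbbD>" and "w2 \<in> \<bbbD>"
    and "\<forall>z\<in>\<bbbD>. log_power h \<alpha> z = c1 * disc_kernel w1 \<alpha> z + c2 * disc_kernel w2 \<alpha> z"
  shows "(\<forall>\<beta>. 1 \<le> \<beta> \<and> \<beta> \<le> \<alpha> \<longrightarrow>
            bergman_norm \<alpha> (2 * \<alpha>) F \<le> bergman_norm \<beta> (2 * \<beta>) F)
       \<and> (\<forall>\<beta>. 1 \<le> \<beta> \<and> \<beta> < \<alpha> \<longrightarrow>
            (bergman_norm \<alpha> (2 * \<alpha>) F = bergman_norm \<beta> (2 * \<beta>) F \<longleftrightarrow>
             (\<exists>c w. w \<in> \<bbbD> \<and> (\<forall>z\<in>\<bbbD>. log_power h \<alpha> z = c * disc_kernel w \<alpha> z))))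
       \<and> bergman_norm \<alpha> (2 * \<alpha>) f \<le> hardy_norm f
       \<and> (bergman_norm \<alpha> (2 * \<alpha>) f = hardy_norm f \<longleftrightarrow>
             (\<exists>c w. w \<in> \<bbbD> \<and> (\<forall>z\<in>\<bbbD>. f z = c * disc_kernel w 1 z)))"
proof -
  note eta = assms(2) and holF = assms(3) and al = assms(7) and w = assms(8,9)
  have feq: "f z = \<eta> z * F z" if "z \<in> \<bbbD>" for z using assms(5) that by blast
  have h: "h holomorphic_on \<bbbD>" and F: "\<And>z. z \<in> \<bbbD> \<Longrightarrow> F z = exp (h z)"
    using assms(6) unfolding holomorphic_log_of_def by auto
  have G: "log_power h \<alpha> z = c1 * disc_kernel w1 \<alpha> z + c2 * disc_kernel w2 \<alpha> z" if "z \<in> \<bbbD>" for z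
    using assms(10) that by blast
  have hol_eta: "\<eta> holomorphic_on \<bbbD>" and eta_le: "\<And>z. z \<in> \<bbbD> \<Longrightarrow> norm (\<eta> z) \<le> 1"
    using eta unfolding inner_function_def by auto
  define single where "single \<longleftrightarrow> (\<exists>c w. w \<in> \<bbbD> \<and> (\<forall>z\<in>\<bbbD>. log_power h \<alpha> z = c * disc_kernel w \<alpha> z))"
  have F_single: "\<exists>A w. A > 0 \<and> w \<in> \<bbbD> \<and> (\<forall>z\<in>\<bbbD>. norm (F z) = A * norm (disc_kernel w 1 z))" if single
  proof -
    from that obtain c w where cw: "w \<in> \<bbbD>" "\<And>z. z \<in> \<bbbD> \<Longrightarrow> log_power h \<alpha> z = c * disc_kernel w \<alpha> z"
      unfolding single_def by blast
    have "norm (F z) = norm c powr (1 / \<alpha>) * norm (disc_kernel w 1 z)" if "z \<in> \<bbbD>" for z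
      by (rule norm_of_log_power_kernel[where h = h and \<alpha> = \<alpha>]) (use al F cw that in auto)
    moreover have "c \<noteq> 0" using cw(2)[of 0] by (auto simp: log_power_def)
    ultimately show ?thesis using cw(1) by (intro exI[of _ "norm c powr (1 / \<alpha>)"] exI[of _ w]) auto
  qed
  have const: "bergman_norm \<beta> (2 * \<beta>) F = bergman_norm \<alpha> (2 * \<alpha>) F" if single "1 \<le> \<beta>" for \<beta>
  proof -
    from F_single[OF that(1)] obtain A w where "A > 0" "w \<in> \<bbbD>" "\<And>z. z \<in> \<bbbD> \<Longrightarrow> norm (F z) = A * norm (disc_kernel w 1 z)"
      by blast
    thus ?thesis using bergman_norm_kernel[of _ w A F] that(2) al by simp
  qed
  have alt: "single \<or> (\<forall>\<beta>. 1 \<le> \<beta> \<and> \<beta> < \<alpha> \<longrightarrow> bergman_norm \<alpha> (2 * \<alpha>) F < bergman_norm \<beta> (2 * \<beta>) F)"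
    unfolding single_def by (rule two_kernel_alternative[OF h F al w G])
  have mono: "bergman_norm \<alpha> (2 * \<alpha>) F \<le> bergman_norm \<beta> (2 * \<beta>) F" if "1 \<le> \<beta>" "\<beta> \<le> \<alpha>" for \<beta>
    using alt const[of \<beta>] that by (cases "\<beta> = \<alpha>") (auto intro: less_imp_le)
  have eq_iff: "bergman_norm \<alpha> (2 * \<alpha>) F = bergman_norm \<beta> (2 * \<beta>) F \<longleftrightarrow> single" if "1 \<le> \<beta>" "\<beta> < \<alpha>" for \<beta>
    using alt const[OF _ that(1)] that by (metis less_irrefl)
  have hardy_F: "hardy_norm g = bergman_norm 1 (2 * 1) g" for g by (simp add: bergman_norm_def)
  define B where "B = (norm c1 * (1 - norm w1) powr (- \<alpha>) + norm c2 * (1 - norm w2) powr (- \<alpha>)) powr (1 / \<alpha>)"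
  have F_bounded: "norm (F z) \<le> B" if z: "z \<in> \<bbbD>" for z
  proof -
    have "norm (log_power h \<alpha> z) \<le> norm (c1 * disc_kernel w1 \<alpha> z) + norm (c2 * disc_kernel w2 \<alpha> z)"
      unfolding G[OF z] by (rule norm_triangle_ineq)
    also have "\<dots> \<le> norm c1 * (1 - norm w1) powr (- \<alpha>) + norm c2 * (1 - norm w2) powr (- \<alpha>)"
      unfolding norm_mult using al w z by (intro add_mono mult_left_mono disc_kernel_norm_le) auto
    finally have "norm (log_power h \<alpha> z) powr (1 / \<alpha>) \<le> B" unfolding B_def using al by (intro powr_mono2) auto
    thus ?thesis unfolding norm_log_power[of F z h, OF F[OF z]] using al by (simp add: powr_powr)
  qed
  have 1: "bergman_norm \<alpha> (2 * \<alpha>) f \<le> bergman_norm \<alpha> (2 * \<alpha>) F"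
    using al feq eta_le by (intro bergman_norm_mono) (auto simp: norm_mult intro!: mult_left_le_one_le)
  have 2: "bergman_norm \<alpha> (2 * \<alpha>) F \<le> hardy_norm F" using mono[of 1] al unfolding hardy_F by simp
  have 3: "hardy_norm F \<le> hardy_norm f" by (rule hardy_norm_inner_multiple[OF eta holF F_bounded feq])
  have "bergman_norm \<alpha> (2 * \<alpha>) f = hardy_norm f \<longleftrightarrow> (\<exists>c w. w \<in> \<bbbD> \<and> (\<forall>z\<in>\<bbbD>. f z = c * disc_kernel w 1 z))"
  proof
    assume "\<exists>c w. w \<in> \<bbbD> \<and> (\<forall>z\<in>\<bbbD>. f z = c * disc_kernel w 1 z)"
    then obtain c w where cw: "w \<in> \<bbbD>" "\<And>z. z \<in> \<bbbD> \<Longrightarrow> f z = c * disc_kernel w 1 z" by blast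
    have "norm (f z) = norm c * norm (disc_kernel w 1 z)" if "z \<in> \<bbbD>" for z using cw(2)[OF that] by (simp add: norm_mult)
    hence "bergman_norm \<beta> (2 * \<beta>) f = ennreal (norm c * (1 - (norm w)\<^sup>2) powr (- 1 / 2))" if "\<beta> \<ge> 1" for \<beta>
      using that by (intro bergman_norm_kernel cw(1)) auto
    from this[of \<alpha>] this[of 1] show "bergman_norm \<alpha> (2 * \<alpha>) f = hardy_norm f" using al unfolding hardy_F by simp
  next
    assume eq: "bergman_norm \<alpha> (2 * \<alpha>) f = hardy_norm f"
    hence eqs: "bergman_norm \<alpha> (2 * \<alpha>) F = hardy_norm F" "bergman_norm \<alpha> (2 * \<alpha>) f = bergman_norm \<alpha> (2 * \<alpha>) F"
      using 1 2 3 by (metis order.antisym order.trans)+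
    have single using eq_iff[of 1] al eqs(1) unfolding hardy_F by simp
    from F_single[OF this] obtain A w where A: "A > 0" "w \<in> \<bbbD>"
      and nF: "\<And>z. z \<in> \<bbbD> \<Longrightarrow> norm (F z) = A * norm (disc_kernel w 1 z)" by blast
    have fin: "bergman_norm \<alpha> (2 * \<alpha>) F < \<infinity>"
      using bergman_norm_kernel[of \<alpha> w A F] A nF al by simp
    have holf: "f holomorphic_on \<bbbD>"
      by (rule holomorphic_transform[of "\<lambda>z. \<eta> z * F z"]) (use hol_eta holF feq in \<open>auto intro!: holomorphic_intros\<close>)
    have "\<exists>z0\<in>\<bbbD>. norm (\<eta> z0) = 1"
    proof (rule ccontr)
      assume "\<not> (\<exists>z0\<in>\<bbbD>. norm (\<eta> z0) = 1)"
      hence lt: "norm (\<eta> z) < 1" if "z \<in> \<bbbD>" for z using eta_le[OF that] that by (auto simp: less_le)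
      have "norm (f z) < norm (F z)" if "z \<in> \<bbbD>" for z
      proof -
        have "norm (F z) > 0" using F[OF that] by simp
        from mult_strict_right_mono[OF lt[OF that] this] show ?thesis unfolding feq[OF that] norm_mult by simp
      qed
      from bergman_norm_strict_mono[OF al holf holF this fin] eqs(2) show False by simp
    qed
    then obtain z0 where z0: "z0 \<in> \<bbbD>" "norm (\<eta> z0) = 1" by blast
    (* If eta has modulus one at z0, then u has maximal modulus there. *)
    define u where "u = (\<lambda>z. f z * (1 - cnj w * z))"
    have nu: "norm (u z) = norm (\<eta> z) * A" if z: "z \<in> \<bbbD>" for z
    proof -
      have "norm (1 - cnj w * z) > 0" using one_minus_cnj_mult_Re_pos[OF A(2) z] by (metis less_irrefl zero_complex.sel(1) zero_less_norm_iff)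
      thus ?thesis unfolding u_def feq[OF z] norm_mult nF[OF z] norm_disc_kernel[OF A(2) z]
        by (simp add: powr_minus field_simps)
    qed
    have "u constant_on \<bbbD>"
    proof (rule maximum_modulus_principle[where U = \<bbbD> and \<xi> = z0])
      show "u holomorphic_on \<bbbD>" unfolding u_def by (intro holomorphic_intros holf)
      show "norm (u z) \<le> norm (u z0)" if "z \<in> \<bbbD>" for z
        using nu[OF that] nu[OF z0(1)] z0(2) eta_le[OF that] A(1) by simp
    qed (use z0 in auto)
    then obtain c where c: "\<And>z. z \<in> \<bbbD> \<Longrightarrow> u z = c" unfolding constant_on_def by blast
    have "f z = c * disc_kernel w 1 z" if z: "z \<in> \<bbbD>" for z
    proof -
      have nz: "1 - cnj w * z \<noteq> 0" using one_minus_cnj_mult_Re_pos[OF A(2) z] by (metis less_irrefl zero_complex.sel(1))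
      have "c = f z * (1 - cnj w * z)" using c[OF z] by (simp add: u_def)
      thus ?thesis using nz by (simp add: disc_kernel_def)
    qed
    with A(2) show "\<exists>c w. w \<in> \<bbbD> \<and> (\<forall>z\<in>\<bbbD>. f z = c * disc_kernel w 1 z)" by blast
  qed
  thus ?thesis using mono eq_iff 1 2 3 unfolding single_def by (auto intro: order.trans)
qed

end
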